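(* Suppose that the processes $S_1=(S_1(n))_{n\in\mathbb{Z}}$ and $S_2=(S_2(n))_{n\in\mathbb{Z}}$ are independent of each other and that each is i.i.d., with $S_1(n)\sim\mathrm{Ber}(p)\mathrm{Geom}(\alpha)$ and $S_2(n)\sim\mathrm{Ber}(q)\mathrm{Geom}(\beta)$. Suppose further that $c(p,\alpha)=c(q,\beta)$. Then there is a coupling of $(S_1,S_2)$ with another pair of processes $(\tilde S_1,\tilde S_2)$ such that: (i) $(S_1,S_2)$ and $(\tilde S_2,\tilde S_1)$ have the same distribution; (ii) if $A$ is any arrival process, then $D_2=\tilde D_2$, where $D_2=D(D(A,S_1),S_2)$ and $\tilde D_2=D(D(A,\tilde S_1),\tilde S_2)$. (The coupling does not depend on $A$: the same coupling works simultaneously for all arrival processes.)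
   Context: **Bernoulli-geometric distribution.** A random variable $Y$ has distribution $\mathrm{Ber}(p)\mathrm{Geom}(\alpha)$ if it is distributed as the product of two independent random variables with $\mathrm{Ber}(p)$ and $\mathrm{Geom}(\alpha)$ distributions, that is, $\mathbb{P}(Y=0)=1-p$ and $\mathbb{P}(Y=k)=p\alpha(1-\alpha)^{k-1}$ for $k\ge1$. For $p,\alpha\in[0,1]$ define $c(p,\alpha)=\frac{p}{1-p}\cdot\frac{\alpha}{1-\alpha}$. **Batch queue.** An arrival process is a process $A=(A(n))_{n\in\mathbb{Z}}$, where $A(n)\ge 0$ is the number of customers (or, more generally, the amount of work, not necessarily an integer) arriving at time $n$; a service process is a process $S=(S(n))_{n\in\mathbb{Z}}$, where $S(n)\ge0$ is the amount of service available at time $n$. Given $A$ and $S$, the queue length is $$X(n)=\sup_{k\le n}\sum_{r=k}^{n-1}(A(r)-S(r))\in[0,\infty]$$ (an empty sum is $0$) and the departure process is $D(n)=\min(X(n)+A(n),S(n))$, written $D=D(A,S)$. No stability assumption is made. Thus $D(D(A,S_1),S_2)$ is the departure process of a tandem of two queues with services $S_1$ then $S_2$, a departure from the first queue at time $n$ being an arrival at the second queue at the same time $n$. *)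

theory Defs
  imports "HOL-Probability.Probability"
begin

text \<open>
  The library's \<open>geometric_pmf a\<close> counts failures before the first success, so it lives on
  \<open>{0, 1, 2, \<dots>}\<close>; the law \<open>Geom(a)\<close> meant here lives on \<open>{1, 2, \<dots>}\<close>, whence the shift by one.
\<close>

definition ber_geom :: "real \<Rightarrow> real \<Rightarrow> real pmf" where
  "ber_geom p a =
     map_pmf (\<lambda>(b, g). of_bool b * real (Suc g)) (pair_pmf (bernoulli_pmf p) (geometric_pmf a))"

lemma pmf_ber_geom_0:
  assumes "p \<in> {0..1}"
  shows "pmf (ber_geom p a) 0 = 1 - p"
proof -
  have eq: "(\<lambda>(b, g). of_bool b * real (Suc g)) -` {0} = (fst -` {False} :: (bool \<times> nat) set)"
    by (intro set_eqI) (simp add: case_prod_beta del: of_nat_Suc)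
  have "pmf (ber_geom p a) 0 = pmf (map_pmf fst (pair_pmf (bernoulli_pmf p) (geometric_pmf a))) False"
    by (simp only: ber_geom_def pmf_map eq)
  then show ?thesis
    using assms by (simp add: map_fst_pair_pmf)
qed

lemma pmf_ber_geom_pos:
  assumes "p \<in> {0..1}" "a \<in> {0<..1}" "k \<ge> 1"
  shows "pmf (ber_geom p a) (real k) = p * a * (1 - a) ^ (k - 1)"
proof -
  have eq: "(\<lambda>(b, g). of_bool b * real (Suc g)) -` {real k} = {(True, k - 1)}"
  proof -
    have "of_bool b * real (Suc g) = real k \<longleftrightarrow> b \<and> g = k - 1" for b g
      using assms(3) by (cases b) (simp, linarith, simp)
    then show ?thesis
      using assms(3) by (auto simp del: of_nat_Suc)
  qed
  show ?thesis
    unfolding ber_geom_def pmf_map eq measure_pmf_single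
    using assms by (simp add: pmf_pair)
qed

text \<open>
  The value is extended real because \<open>p = 1\<close> and \<open>a = 1\<close> are allowed: there
  \<open>1 / 0 = \<infinity>\<close> in type \<open>ereal\<close> (in type \<open>real\<close> it would be \<open>0\<close>), and \<open>0 \<cdot> \<infinity> = 0\<close>.
\<close>

definition c_param :: "real \<Rightarrow> real \<Rightarrow> ereal" where
  "c_param p a = (ereal p / ereal (1 - p)) * (ereal a / ereal (1 - a))"

definition queue_length :: "(int \<Rightarrow> real) \<Rightarrow> (int \<Rightarrow> real) \<Rightarrow> int \<Rightarrow> ereal" where
  "queue_length A S n = (SUP k\<in>{..n}. ereal (\<Sum>r\<in>{k..<n}. A r - S r))"

text \<open>
  The queue length may be infinite, but the minimum below is always finite, so that
  \<open>real_of_ereal\<close> loses nothing; see \<open>ereal_departure\<close>.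
\<close>

definition departure :: "(int \<Rightarrow> real) \<Rightarrow> (int \<Rightarrow> real) \<Rightarrow> int \<Rightarrow> real" where
  "departure A S n = real_of_ereal (min (queue_length A S n + ereal (A n)) (ereal (S n)))"

lemma queue_length_nonneg: "queue_length A S n \<ge> 0"
  unfolding queue_length_def by (rule SUP_upper2[where i = n]) auto

lemma ereal_departure:
  "ereal (departure A S n) = min (queue_length A S n + ereal (A n)) (ereal (S n))"
  using queue_length_nonneg[of A S n] unfolding departure_def
  by (cases "queue_length A S n") (auto simp: min_def)

lemma departure_nonneg:
  assumes "A n \<ge> 0" "S n \<ge> 0"
  shows "departure A S n \<ge> 0"
proof -
  have "0 \<le> min (queue_length A S n + ereal (A n)) (ereal (S n))"
    using assms queue_length_nonneg[of A S n] by (simp add: add_nonneg_nonneg)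
  then show ?thesis
    by (simp flip: ereal_departure)
qed

abbreviation proc_space :: "(int \<Rightarrow> real) measure" where
  "proc_space \<equiv> (\<Pi>\<^sub>M n\<in>UNIV. borel)"

abbreviation proc_pair_space :: "((int \<Rightarrow> real) \<times> (int \<Rightarrow> real)) measure" where
  "proc_pair_space \<equiv> proc_space \<Otimes>\<^sub>M proc_space"

end

(*
  Run a queue with content x, arrivals s1 and service s2 in stationarity. Backwards in time it is
  again such a queue: its arrivals are the departures t2, its departures are s1, and its service t1
  equals s1 while x > 0 and is resampled from the law of the service, conditioned to be at least s1,
  when x = 0. Equality of the parameters c is exactly the detailed balance equation behind this
  reversal, and hence (t2, t1) has the law of (s1, s2). On the other hand, whatever the values of t1
  at the times when x = 0, the tandems with services (s1, s2) and (t1, t2) have the same output: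
  started from empty, the two tandems always contain the same total amount of work, and the second
  queue of the first tandem is the minimum of x and the second queue of the other one. A process that
  has always been arriving is the increasing limit of its truncations. If the arrivals s1 are not
  slower than the service s2, then either the two laws agree or the roles of the pairs are exchanged.
*)
theory Submission
  imports Defs
begin

section \<open>Pathwise interchange of the services\<close>

lemma queue_length_step:
  "queue_length A S (n + 1) = max 0 (queue_length A S n + ereal (A n - S n))"
proof -
  let ?f = "\<lambda>k. ereal (\<Sum>r\<in>{k..<n}. A r - S r)"
  have ins: "{..n + 1} = insert (n + 1) {..n}"
    by auto
  \<comment> \<open>The starting point k = n + 1 gives the empty sum, hence the 0; every other sum
    gains the same last term, which can be taken out of the supremum.\<close>
  have "queue_length A S (n + 1) = sup 0 (SUP k\<in>{..n}. ereal (\<Sum>r\<in>{k..<n + 1}. A r - S r))"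
    unfolding queue_length_def ins SUP_insert by (simp add: zero_ereal_def)
  also have "(SUP k\<in>{..n}. ereal (\<Sum>r\<in>{k..<n + 1}. A r - S r)) = (SUP k\<in>{..n}. ?f k + ereal (A n - S n))"
  proof (rule SUP_cong)
    fix k assume "k \<in> {..n}"
    then have "{k..<n + 1} = insert n {k..<n}"
      by auto
    then show "ereal (\<Sum>r\<in>{k..<n + 1}. A r - S r) = ?f k + ereal (A n - S n)"
      by simp
  qed simp
  also have "\<dots> = (SUP k\<in>{..n}. ?f k) + ereal (A n - S n)"
    by (rule SUP_ereal_add_left) auto
  finally show ?thesis
    by (simp add: queue_length_def sup_max)
qed

lemma queue_length_eq_0:
  assumes "\<And>r. r < n \<Longrightarrow> A r \<le> S r"
  shows "queue_length A S n = 0"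
proof (rule antisym)
  show "queue_length A S n \<le> 0"
    unfolding queue_length_def using assms
    by (intro SUP_least) (auto simp: zero_ereal_def intro!: sum_nonpos)
qed (rule queue_length_nonneg)

lemma departure_eq_real:
  assumes "queue_length A S n = ereal x"
  shows "departure A S n = min (x + A n) (S n)"
  using assms unfolding departure_def by (simp add: min_def)

lemma departure_eq_0:
  assumes "\<And>r. r < n \<Longrightarrow> A r \<le> S r" "A n = 0" "0 \<le> S n"
  shows "departure A S n = 0"
  using assms by (simp add: departure_def queue_length_eq_0 min_def)

section \<open>Monotone limits of arrival processes\<close>

lemma queue_length_mono:
  assumes "\<And>n. B n \<le> C n"
  shows "queue_length B S n \<le> queue_length C S n"
  unfolding queue_length_def
  by (intro SUP_mono) (use assms in \<open>auto intro!: bexI sum_mono\<close>)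

lemma departure_mono:
  assumes "\<And>n. B n \<le> C n"
  shows "departure B S n \<le> departure C S n"
proof -
  have "ereal (departure B S n) \<le> ereal (departure C S n)"
    unfolding ereal_departure
    by (intro min.mono add_mono queue_length_mono) (simp_all add: assms)
  then show ?thesis
    by simp
qed

text \<open>For increasing arrivals limits are suprema, and the supremum over j commutes with the
  one over k that defines the queue length. Monotonicity of the departures is part of the conclusion
  so that the lemma applies again to the second queue of a tandem.\<close>

lemma departure_incseq_tendsto:
  assumes inc: "\<And>n. incseq (\<lambda>j. B j n)" and lim: "\<And>n. (\<lambda>j. B j n) \<longlonglongrightarrow> C n"
  shows "incseq (\<lambda>j. departure (B j) S n)" "(\<lambda>j. departure (B j) S n) \<longlonglongrightarrow> departure C S n"
proof -
  have mono: "B i n \<le> B j n" if "i \<le> j" for i j n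
    using inc that by (auto simp: incseq_def)
  then show "incseq (\<lambda>j. departure (B j) S n)"
    unfolding incseq_def by (auto intro!: departure_mono)
  have sup: "(SUP j. ereal (\<Sum>r\<in>{k..<n}. B j r - S r)) = ereal (\<Sum>r\<in>{k..<n}. C r - S r)" for k
  proof (rule LIMSEQ_unique[OF LIMSEQ_SUP])
    show "incseq (\<lambda>j. ereal (\<Sum>r\<in>{k..<n}. B j r - S r))"
      unfolding incseq_def using mono by (auto intro!: sum_mono)
    show "(\<lambda>j. ereal (\<Sum>r\<in>{k..<n}. B j r - S r)) \<longlonglongrightarrow> ereal (\<Sum>r\<in>{k..<n}. C r - S r)"
      using lim by (auto intro!: tendsto_intros)
  qed
  have "queue_length C S n = (SUP j. queue_length (B j) S n)"
    unfolding queue_length_def sup[symmetric] by (rule SUP_commute)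
  moreover have "(\<lambda>j. queue_length (B j) S n) \<longlonglongrightarrow> (SUP j. queue_length (B j) S n)"
    by (rule LIMSEQ_SUP) (auto simp: incseq_def intro!: queue_length_mono mono)
  ultimately have "(\<lambda>j. queue_length (B j) S n) \<longlonglongrightarrow> queue_length C S n"
    by simp
  \<comment> \<open>The limiting queue length may be infinite; addition is still continuous there
    because \<open>C n\<close> is real.\<close>
  then have "(\<lambda>j. queue_length (B j) S n + ereal (B j n)) \<longlonglongrightarrow> queue_length C S n + ereal (C n)"
    using lim by (intro tendsto_add_ereal_general1) auto
  then have "(\<lambda>j. ereal (departure (B j) S n)) \<longlonglongrightarrow> ereal (departure C S n)"
    unfolding ereal_departure by (intro tendsto_min tendsto_const)
  then show "(\<lambda>j. departure (B j) S n) \<longlonglongrightarrow> departure C S n"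
    by simp
qed

text \<open>
  One time step of a queue with content \<open>x\<close> before and \<open>x'\<close> after it, arrivals \<open>a\<close>, service \<open>s\<close>
  and departures \<open>d\<close>. Exchanging \<open>(x, a, s)\<close> with \<open>(x', d, r)\<close> gives the same relation, so that
  \<open>r\<close> is the service of the queue run backwards in time, in which \<open>d\<close> arrives and \<open>a\<close> departs.
\<close>

definition reversible_step :: "'a::linordered_semidom \<Rightarrow> 'a \<Rightarrow> 'a \<Rightarrow> 'a \<Rightarrow> 'a \<Rightarrow> 'a \<Rightarrow> bool" where
  "reversible_step x a s d r x' \<longleftrightarrow>
     x + a = x' + d \<and> d \<le> s \<and> a \<le> r \<and> (0 < x' \<longrightarrow> s = d) \<and> (0 < x \<longrightarrow> r = a)"

text \<open>
  \<open>x1\<close>, \<open>x2\<close> are the queues of the tandem with services \<open>a\<close>, \<open>s\<close>, and \<open>y1\<close>, \<open>y2\<close> those of the tandem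
  with services \<open>r\<close>, \<open>d\<close>. The invariant that makes the induction work is \<open>x2 = min y2 x\<close> together
  with equality of the total contents.
\<close>

lemma tandem_interchange_step:
  fixes x :: real
  assumes "reversible_step x a s d r x'" "0 \<le> x" "0 \<le> x'" "0 \<le> a" "0 \<le> d" "0 \<le> A"
    and "0 \<le> x1" "0 \<le> x2" "0 \<le> y1" "0 \<le> y2"
    and "x1 + x2 = y1 + y2" "x2 = min y2 x"
  defines "d1 \<equiv> min (x1 + A) a" and "e1 \<equiv> min (y1 + A) r"
  shows "min (x2 + d1) s = min (y2 + e1) d"
    and "max 0 (x1 + (A - a)) + max 0 (x2 + (d1 - s)) = max 0 (y1 + (A - r)) + max 0 (y2 + (e1 - d))"
    and "max 0 (x2 + (d1 - s)) = min (max 0 (y2 + (e1 - d))) x'"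
proof -
  have R: "x + a = x' + d" "d \<le> s" "a \<le> r" "0 < x' \<Longrightarrow> s = d" "0 < x \<Longrightarrow> r = a"
    using assms(1) by (auto simp: reversible_step_def)
  have d: "d = min (x + a) s"
    using R \<open>0 \<le> x'\<close> by (cases "x' = 0") auto
  \<comment> \<open>For x > 0 this is the invariant shifted by r = a; for x = 0 the invariant forces
    x2 = 0, and a \<le> r takes over.\<close>
  have arr: "x2 + a = min (y2 + r) (x + a)"
    using R(3,5) assms(8,10,12) \<open>0 \<le> x\<close> by (cases "x = 0") (auto simp: min_def)
  have total: "x2 + d1 = min (x1 + x2 + A) (x2 + a)" "y2 + e1 = min (x1 + x2 + A) (y2 + r)"
    using assms(11) unfolding d1_def e1_def by linarith+
  \<comment> \<open>With T = x1 + x2 + A, both sides are the minimum of T, y2 + r, x + a and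
    s.\<close>
  show eq: "min (x2 + d1) s = min (y2 + e1) d"
    unfolding total d using arr by (auto simp: min_def split: if_splits)
  \<comment> \<open>What remains in a queue is what was available minus what leaves, so equal
    outputs keep the total contents equal.\<close>
  have m: "max 0 (u + (v - w)) = u + v - min (u + v) w" for u v w :: real
    by (simp add: min_def max_def)
  show "max 0 (x1 + (A - a)) + max 0 (x2 + (d1 - s)) = max 0 (y1 + (A - r)) + max 0 (y2 + (e1 - d))"
    unfolding m eq using assms(11) unfolding d1_def e1_def by simp
  show "max 0 (x2 + (d1 - s)) = min (max 0 (y2 + (e1 - d))) x'"
  \<comment> \<open>If x' = 0, then x2 + d1 \<le> x + a = d \<le> s, so the second queue empties. If
    x' > 0, then s = d, and x2 + d1 is the minimum of y2 + e1 and x' + d.\<close>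
  proof (cases "x' = 0")
    case True
    then have "x2 + d1 \<le> s"
      using R assms(12) unfolding d1_def by auto
    then show ?thesis
      using True by simp
  next
    case False
    then have "s = d" "d < x + a"
      using R \<open>0 \<le> x'\<close> by auto
    then show ?thesis
      using R(1) total arr by (auto simp: min_def max_def split: if_splits)
  qed
qed

text \<open>Both tandems are empty at time m, where the invariant reads 0 = min 0 (X m); each later
  step preserves the invariant and makes the outputs equal.\<close>

lemma tandem_interchange_from_empty:
  fixes X a s d r A :: "int \<Rightarrow> real"
  assumes step: "\<And>n. reversible_step (X n) (a n) (s n) (d n) (r n) (X (n + 1))"
    and nn: "\<And>n. 0 \<le> X n" "\<And>n. 0 \<le> a n" "\<And>n. 0 \<le> s n" "\<And>n. 0 \<le> d n" "\<And>n. 0 \<le> r n"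
    and A: "\<And>n. 0 \<le> A n" "\<And>n. n < m \<Longrightarrow> A n = 0"
  shows "departure (departure A a) s n = departure (departure A r) d n"
proof (cases "n < m")
  case True
  have "departure A a k = 0" "departure A r k = 0" if "k < m" for k
    using that A nn by (auto intro!: departure_eq_0)
  then show ?thesis
    using True nn by (simp add: departure_eq_0)
next
  case False
  let ?D = "departure A a" and ?E = "departure A r"
  have zero: "?D k = 0" "?E k = 0" if "k < m" for k
    using that A nn by (auto intro!: departure_eq_0)
  \<comment> \<open>\<open>coupled\<close> also records that all four contents are finite, since the
    step lemma is about reals.\<close>
  define coupled where "coupled n \<longleftrightarrow> (\<exists>x1 x2 y1 y2. queue_length A a n = ereal x1 \<and>
      queue_length ?D s n = ereal x2 \<and> queue_length A r n = ereal y1 \<and> queue_length ?E d n = ereal y2 \<and>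
      x1 + x2 = y1 + y2 \<and> x2 = min y2 (X n))" for n
  have coupled_step: "coupled (n + 1) \<and> departure ?D s n = departure ?E d n" if "coupled n" for n
  proof -
    from that obtain x1 x2 y1 y2 where q: "queue_length A a n = ereal x1" "queue_length ?D s n = ereal x2"
      "queue_length A r n = ereal y1" "queue_length ?E d n = ereal y2"
      and inv: "x1 + x2 = y1 + y2" "x2 = min y2 (X n)"
      unfolding coupled_def by blast
    have D: "?D n = min (x1 + A n) (a n)" "?E n = min (y1 + A n) (r n)"
      using q by (simp_all add: departure_eq_real)
    have "0 \<le> x1" "0 \<le> x2" "0 \<le> y1" "0 \<le> y2"
      using queue_length_nonneg[of A a n] queue_length_nonneg[of ?D s n]
        queue_length_nonneg[of A r n] queue_length_nonneg[of ?E d n] by (auto simp: q)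
    note * = tandem_interchange_step[OF step nn(1) nn(1) nn(2) nn(4) A(1) this inv, of n, folded D]
    have q': "queue_length A a (n + 1) = ereal (max 0 (x1 + (A n - a n)))"
      "queue_length ?D s (n + 1) = ereal (max 0 (x2 + (?D n - s n)))"
      "queue_length A r (n + 1) = ereal (max 0 (y1 + (A n - r n)))"
      "queue_length ?E d (n + 1) = ereal (max 0 (y2 + (?E n - d n)))"
      unfolding queue_length_step q by (simp_all add: zero_ereal_def)
    have "coupled (n + 1)"
      unfolding coupled_def by (intro exI conjI) (fact q' *(2,3))+
    moreover have "departure ?D s n = departure ?E d n"
      unfolding departure_eq_real[OF q(2)] departure_eq_real[OF q(4)] by (fact *(1))
    ultimately show ?thesis
      by simp
  qed
  have "coupled n"
    using False[unfolded not_less]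
  proof (induction n rule: int_ge_induct)
    case base
    have "queue_length A a m = 0" "queue_length ?D s m = 0" "queue_length A r m = 0" "queue_length ?E d m = 0"
      using A nn zero by (auto intro!: queue_length_eq_0)
    then show ?case
      using nn(1)[of m] by (auto simp: coupled_def zero_ereal_def min_def)
  next
    case (step i)
    then show ?case
      by (simp add: coupled_step)
  qed
  then show ?thesis
    by (simp add: coupled_step)
qed

lemma tandem_interchange:
  fixes X a s d r A :: "int \<Rightarrow> real"
  assumes step: "\<And>n. reversible_step (X n) (a n) (s n) (d n) (r n) (X (n + 1))"
    and nn: "\<And>n. 0 \<le> X n" "\<And>n. 0 \<le> a n" "\<And>n. 0 \<le> s n" "\<And>n. 0 \<le> d n" "\<And>n. 0 \<le> r n"
    and A: "\<And>n. 0 \<le> A n"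
  shows "departure (departure A a) s = departure (departure A r) d"
proof
  fix n
  \<comment> \<open>The truncations vanish before time -j and increase to A because A \<ge>
    0.\<close>
  define B where "B j n = (if n < - int j then 0 else A n)" for j n
  have inc: "incseq (\<lambda>j. B j n)" for n
    unfolding incseq_def B_def using A by auto
  have lim: "(\<lambda>j. B j n) \<longlonglongrightarrow> A n" for n
  proof (rule tendsto_eventually)
    show "\<forall>\<^sub>F j in sequentially. B j n = A n"
      using eventually_ge_at_top[of "nat \<bar>n\<bar>"] by eventually_elim (auto simp: B_def)
  qed
  \<comment> \<open>Continuity is used once per queue: the departures of the first queue converge
    monotonically, as the second one requires of its arrivals.\<close>
  have tendsto: "(\<lambda>j. departure (departure (B j) S) S' n) \<longlonglongrightarrow> departure (departure A S) S' n" for S S'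
    by (rule departure_incseq_tendsto(2)) (rule departure_incseq_tendsto[OF inc lim])+
  have "departure (departure (B j) a) s n = departure (departure (B j) r) d n" for j
    by (rule tandem_interchange_from_empty[of X a s d r "B j" "- int j"]) (auto simp: B_def step nn A)
  then show "departure (departure A a) s n = departure (departure A r) d n"
    using LIMSEQ_unique[OF tendsto[of a s]] tendsto[of r d] by simp
qed

section \<open>Reversibility of the Bernoulli-geometric queue\<close>

lemma pmf_bind_map_Pair:
  "pmf (bind_pmf P (\<lambda>z. map_pmf (Pair z) (K z))) (z, r) = pmf P z * pmf (K z) r"
proof -
  have "pmf (map_pmf (Pair z') (K z')) (z, r) = indicator {z} z' * pmf (K z) r" for z'
  proof (cases "z' = z")
    case True
    then show ?thesis
      by (simp add: pmf_map_inj' inj_def)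
  next
    case False
    then show ?thesis
      by (auto simp: pmf_eq_0_set_pmf)
  qed
  then show ?thesis
    by (simp add: pmf_bind measure_pmf_single)
qed

text \<open>On V the map is a bijection that permutes points of equal mass. The condition is
  confined to V because \<open>reverse_step\<close> inverts itself only on configurations that
  respect the service constraints.\<close>

lemma map_pmf_involution:
  assumes supp: "set_pmf P \<subseteq> V" and V: "\<And>v. v \<in> V \<Longrightarrow> \<tau> v \<in> V \<and> \<tau> (\<tau> v) = v"
    and inv: "\<And>v. v \<in> V \<Longrightarrow> pmf P (\<tau> v) = pmf P v"
  shows "map_pmf \<tau> P = P"
proof (rule pmf_eqI)
  fix v
  have inj: "inj_on \<tau> (set_pmf P)"
    using supp V by (metis inj_on_def subsetD)
  show "pmf (map_pmf \<tau> P) v = pmf P v"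
  proof (cases "v \<in> \<tau> ` set_pmf P")
    case True
    then obtain u where u: "u \<in> set_pmf P" "v = \<tau> u"
      by auto
    then show ?thesis
      using supp inv inj by (auto simp: pmf_map_inj)
  next
    case False
    have "v \<notin> set_pmf P"
    proof
      assume "v \<in> set_pmf P"
      then have "\<tau> v \<in> set_pmf P" "\<tau> (\<tau> v) = v"
        using inv supp V by (auto simp: set_pmf_iff subset_iff)
      then show False
        using False by (metis imageI)
    qed
    then show ?thesis
      using False by (simp add: pmf_map_outside pmf_eq_0_set_pmf)
  qed
qed

section \<open>Laws on the naturals and detailed balance\<close>

definition ber_geom_nat :: "real \<Rightarrow> real \<Rightarrow> nat pmf" where
  "ber_geom_nat p a = map_pmf (\<lambda>(b, g). of_bool b * Suc g) (pair_pmf (bernoulli_pmf p) (geometric_pmf a))"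

lemma ber_geom_eq_map: "ber_geom p a = map_pmf real (ber_geom_nat p a)"
  unfolding ber_geom_def ber_geom_nat_def map_pmf_comp
  by (intro map_pmf_cong) (auto simp: of_bool_def)

lemma pmf_ber_geom_nat_real: "pmf (ber_geom_nat p a) k = pmf (ber_geom p a) (real k)"
  unfolding ber_geom_eq_map by (simp add: pmf_map_inj' inj_def)

lemma pmf_ber_geom_nat:
  assumes "p \<in> {0..1}" "a \<in> {0<..1}"
  shows "pmf (ber_geom_nat p a) 0 = 1 - p" "pmf (ber_geom_nat p a) (Suc k) = p * a * (1 - a) ^ k"
  using pmf_ber_geom_0[of p a] pmf_ber_geom_pos[of p a "Suc k"] assms
  unfolding pmf_ber_geom_nat_real by simp_all

text \<open>\<rho> is the decay ratio of the stationary queue length, and \<rho> < 1 makes its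
  weights summable. For \<beta> < 1 the two equations amount to \<rho> = (1 - \<alpha>) / (1 -
  \<beta>) and to c(p, \<alpha>) = c(q, \<beta>) cleared of denominators; kept free of division,
  they also make sense for parameters equal to 1.\<close>

locale reversible_queue =
  fixes p \<alpha> q \<beta> \<rho> :: real
  assumes p: "p \<in> {0..1}" and \<alpha>: "\<alpha> \<in> {0<..1}" and q: "q \<in> {0..1}" and \<beta>: "\<beta> \<in> {0<..1}"
    and \<rho>: "\<rho> \<in> {0..<1}"
    and ratio: "1 - \<alpha> = \<rho> * (1 - \<beta>)" and balance: "\<rho> * (1 - p) * (q * \<beta>) = p * \<alpha> * (1 - q)"
begin

abbreviation arr :: "nat pmf" where "arr \<equiv> ber_geom_nat p \<alpha>"
abbreviation srv :: "nat pmf" where "srv \<equiv> ber_geom_nat q \<beta>"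

text \<open>The normalised weights 1, \<beta>\<rho>, \<beta>\<rho>^2, and so on; the Bernoulli
  parameter is the share of the positive values in the total weight.\<close>

definition stat :: "nat pmf" where
  "stat = ber_geom_nat (\<beta> * \<rho> / (1 - \<rho> + \<beta> * \<rho>)) (1 - \<rho>)"

lemma pmf_arr: "pmf arr 0 = 1 - p" "pmf arr (Suc k) = p * \<alpha> * (1 - \<alpha>) ^ k"
  using pmf_ber_geom_nat[OF p \<alpha>] by auto

lemma pmf_srv: "pmf srv 0 = 1 - q" "pmf srv (Suc k) = q * \<beta> * (1 - \<beta>) ^ k"
  using pmf_ber_geom_nat[OF q \<beta>] by auto

lemma pmf_stat: "pmf stat (Suc k) = pmf stat 0 * \<beta> * \<rho> ^ Suc k"
proof -
  have *: "0 < 1 - \<rho> + \<beta> * \<rho>"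
    using \<rho> \<beta> by (auto intro: add_pos_nonneg)
  then have "\<beta> * \<rho> / (1 - \<rho> + \<beta> * \<rho>) \<in> {0..1}" "1 - \<rho> \<in> {0<..1}"
    using \<rho> \<beta> by (auto simp: divide_simps)
  note pmf = pmf_ber_geom_nat[OF this]
  have "1 - \<beta> * \<rho> / (1 - \<rho> + \<beta> * \<rho>) = (1 - \<rho>) / (1 - \<rho> + \<beta> * \<rho>)"
    using * by (simp add: divide_simps)
  then show ?thesis
    unfolding stat_def pmf by simp
qed

text \<open>
  Given the queue length and the amount that passes through, the service offered is known
  exactly while the queue is nonempty; an empty queue only says that the service
  was at least that amount, and then the memoryless tail decides the rest.
\<close>

definition service_given :: "nat \<Rightarrow> nat \<Rightarrow> nat pmf" where
  "service_given x k =
     (if x > 0 then return_pmf k else if k = 0 then srv else map_pmf ((+) k) (geometric_pmf \<beta>))"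

text \<open>The probability of the event on which \<open>service_given\<close> conditions: service
  equal to k when x > 0, at least k when x = 0.\<close>

definition service_weight :: "nat \<Rightarrow> nat \<Rightarrow> real" where
  "service_weight x k =
     (if x > 0 then pmf srv k else if k = 0 then 1 else q * (1 - \<beta>) ^ (k - 1))"

lemma set_service_given: "s \<in> set_pmf (service_given x k) \<Longrightarrow> k \<le> s \<and> (0 < x \<longrightarrow> s = k)"
  by (auto simp: service_given_def split: if_splits)

text \<open>Bayes' rule for that event, written as a product so that events of weight 0 need no
  separate case.\<close>

lemma pmf_srv_eq:
  assumes "k \<le> s" "0 < x \<Longrightarrow> s = k"
  shows "pmf srv s = service_weight x k * pmf (service_given x k) s"
proof -
  have "pmf (map_pmf ((+) k) (geometric_pmf \<beta>)) s = \<beta> * (1 - \<beta>) ^ (s - k)"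
    using pmf_map_inj'[of "(+) k" "geometric_pmf \<beta>" "s - k"] assms \<beta> by simp
  moreover have "pmf srv s = q * \<beta> * (1 - \<beta>) ^ (k - 1 + (s - k))" if "k > 0"
    using that assms(1) by (cases s; cases k) (auto simp: pmf_srv)
  ultimately show ?thesis
    using assms by (auto simp: service_weight_def service_given_def simp flip: power_add)
qed

text \<open>Exchanging (x, a) with (x', d) exchanges the two sides, so one sign of x - x' is enough;
  \<open>*\<close> is the case in which the queue drops by i + 1. For a > 0 the powers match by
  \<open>ratio\<close>; for a = 0 the atoms at 0 appear and \<open>balance\<close> enters.\<close>

lemma detailed_balance:
  assumes "x + a = x' + d"
  shows "pmf stat x * pmf arr a * service_weight x' d = pmf stat x' * pmf arr d * service_weight x a"
proof -
  have *: "pmf stat (x' + Suc i) * pmf arr a * service_weight x' (a + Suc i)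
      = pmf stat x' * pmf arr (a + Suc i) * service_weight (x' + Suc i) a" for x' a i
  proof -
    have bal: "p * \<alpha> * (1 - q) = \<rho> * (1 - p) * (q * \<beta>)"
      using balance by simp
    have A: "pmf arr (Suc k) = p * \<alpha> * (\<rho> ^ k * (1 - \<beta>) ^ k)" for k
      by (simp add: pmf_arr ratio power_mult_distrib)
    show ?thesis
    proof (cases a)
      case 0
      have "\<rho> * ((1 - p) * (q * (1 - \<beta>) ^ i)) * \<beta> = p * \<alpha> * (1 - \<beta>) ^ i * (1 - q)"
        using arg_cong[OF bal, of "\<lambda>t. t * (1 - \<beta>) ^ i"] by (simp only: mult_ac)
      then show ?thesis
        using 0 by (cases x')
          (auto simp: pmf_stat pmf_srv A pmf_arr(1) service_weight_def power_add mult_ac)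
    next
      case (Suc k)
      then show ?thesis
        by (cases x') (simp_all add: pmf_stat pmf_srv A service_weight_def power_add)
    qed
  qed
  show ?thesis
  proof (cases x x' rule: linorder_cases)
    case less
    then obtain i where "x' = x + Suc i"
      using less_imp_Suc_add by auto
    with assms have "a = d + Suc i"
      by simp
    then show ?thesis
      using *[of x i d] \<open>x' = x + Suc i\<close> by simp
  next
    case equal
    then show ?thesis
      using assms by simp
  next
    case greater
    then obtain i where "x = x' + Suc i"
      using less_imp_Suc_add by auto
    with assms have "d = a + Suc i"
      by simp
    then show ?thesis
      using *[of x' i a] \<open>x = x' + Suc i\<close> by simp
  qed
qed

section \<open>Time reversal of one stationary step\<close>

definition transition :: "((nat \<times> nat \<times> nat) \<times> nat) pmf" where
  "transition = bind_pmf (pair_pmf stat (pair_pmf arr srv))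
     (\<lambda>z. map_pmf (Pair z) (case z of (x, a, s) \<Rightarrow> service_given x a))"

fun reverse_step :: "(nat \<times> nat \<times> nat) \<times> nat \<Rightarrow> (nat \<times> nat \<times> nat) \<times> nat" where
  "reverse_step ((x, a, s), r) = (let d = min (x + a) s in ((x + a - d, d, r), s))"

text \<open>The point mass of a configuration is one side of detailed balance times two conditional
  service laws; reversal swaps these two laws and passes to the other side.\<close>

lemma map_reverse_step_transition: "map_pmf reverse_step transition = transition"
proof (rule map_pmf_involution[where V = "{((x, a, s), r). a \<le> r \<and> (0 < x \<longrightarrow> r = a)}"])
  show "set_pmf transition \<subseteq> {((x, a, s), r). a \<le> r \<and> (0 < x \<longrightarrow> r = a)}"
    using set_service_given by (auto simp: transition_def)
next
  fix v :: "(nat \<times> nat \<times> nat) \<times> nat"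
  obtain x a s r where v: "v = ((x, a, s), r)"
    by (metis surj_pair)
  define d where "d = min (x + a) s"
  define x' where "x' = x + a - d"
  assume "v \<in> {((x, a, s), r). a \<le> r \<and> (0 < x \<longrightarrow> r = a)}"
  then have r: "a \<le> r" "0 < x \<Longrightarrow> r = a"
    by (auto simp: v)
  have s: "d \<le> s" "0 < x' \<Longrightarrow> s = d" and flow: "x + a = x' + d"
    by (auto simp: d_def x'_def)
  \<comment> \<open>The reversed step releases a and leaves the content x, which is the involution
    property.\<close>
  have a: "a = min (x' + d) r" "x = x' + d - a"
    using r flow by (cases "x = 0"; simp)+
  have \<tau>v: "reverse_step v = ((x', d, r), s)"
    by (simp add: v d_def x'_def Let_def)
  moreover have "reverse_step ((x', d, r), s) = v"
    using a by (simp add: v Let_def)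
  ultimately show "reverse_step v \<in> {((x, a, s), r). a \<le> r \<and> (0 < x \<longrightarrow> r = a)} \<and> reverse_step (reverse_step v) = v"
    using s by auto
  have "pmf transition ((x, a, s), r) = pmf stat x * pmf arr a * service_weight x' d
      * pmf (service_given x' d) s * pmf (service_given x a) r"
    unfolding transition_def pmf_bind_map_Pair by (simp add: pmf_pair pmf_srv_eq[OF s])
  moreover have "pmf transition ((x', d, r), s) = pmf stat x' * pmf arr d * service_weight x a
      * pmf (service_given x a) r * pmf (service_given x' d) s"
    unfolding transition_def pmf_bind_map_Pair by (simp add: pmf_pair pmf_srv_eq[OF r])
  ultimately show "pmf transition (reverse_step v) = pmf transition v"
    unfolding \<tau>v unfolding v using detailed_balance[OF flow] by simp
qed

text \<open>
  Of an input \<open>(a, s, e, g)\<close>, the last two components are the extra randomness from which a sample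
  of \<^term>\<open>service_given x a\<close> is built.
\<close>

definition input :: "(nat \<times> nat \<times> nat \<times> nat) pmf" where
  "input = pair_pmf arr (pair_pmf srv (pair_pmf srv (geometric_pmf \<beta>)))"

fun step :: "nat \<Rightarrow> nat \<times> nat \<times> nat \<times> nat \<Rightarrow> nat \<times> nat \<times> nat" where
  "step x (a, s, e, g) =
     (let d = min (x + a) s in (x + a - d, d, if x > 0 then a else if a = 0 then e else a + g))"

lemma service_given_eq_map:
  "service_given x a = map_pmf (\<lambda>(e, g). if x > 0 then a else if a = 0 then e else a + g)
     (pair_pmf srv (geometric_pmf \<beta>))"
proof -
  have "map_pmf (\<lambda>(e, g). (+) a g) (pair_pmf srv (geometric_pmf \<beta>)) = map_pmf ((+) a) (geometric_pmf \<beta>)"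
    by (simp add: map_snd_pair_pmf map_pmf_comp[symmetric, of "(+) a" snd, simplified] case_prod_beta')
  moreover have "map_pmf (\<lambda>(e, g). e) (pair_pmf srv (geometric_pmf \<beta>)) = srv"
    by (simp add: map_fst_pair_pmf case_prod_beta')
  ultimately show ?thesis
    by (auto simp: service_given_def case_prod_beta')
qed

text \<open>A Burke-type property: after a stationary step, the content, the departure and the
  reversed service are independent and have the laws of content, arrival and service. It is read off
  from the first component of the reversed \<open>transition\<close>.\<close>

lemma map_step: "map_pmf (\<lambda>(x, w). step x w) (pair_pmf stat input) = pair_pmf stat (pair_pmf arr srv)"
proof -
  have "map_pmf (\<lambda>(x, w). step x w) (pair_pmf stat input) = map_pmf (fst \<circ> reverse_step) transition"
    unfolding transition_def input_def service_given_eq_map pair_pmf_def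
    by (simp add: map_bind_pmf bind_map_pmf bind_assoc_pmf bind_return_pmf map_pmf_def case_prod_beta' Let_def
        cong: if_cong)
  also have "\<dots> = map_pmf fst (map_pmf reverse_step transition)"
    by (simp only: map_pmf_comp o_def)
  also have "\<dots> = map_pmf fst transition"
    by (simp only: map_reverse_step_transition)
  also have "\<dots> = pair_pmf stat (pair_pmf arr srv)"
    unfolding transition_def by (simp add: map_bind_pmf map_pmf_comp bind_return_pmf')
  finally show ?thesis .
qed

end

section \<open>Independent processes in one product space\<close>

lemma distr_proc_pair:
  assumes "prob_space M"
    and "prob_space.indep_vars M (\<lambda>_. borel) S1 (UNIV :: int set)" "\<And>n. distr M borel (S1 n) = \<mu>1"
    and "prob_space.indep_vars M (\<lambda>_. borel) S2 (UNIV :: int set)" "\<And>n. distr M borel (S2 n) = \<mu>2"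
    and "prob_space.indep_var M proc_space (\<lambda>\<omega> n. S1 n \<omega>) proc_space (\<lambda>\<omega> n. S2 n \<omega>)"
  shows "distr M proc_pair_space (\<lambda>\<omega>. (\<lambda>n. S1 n \<omega>, \<lambda>n. S2 n \<omega>))
    = (\<Pi>\<^sub>M n\<in>UNIV. \<mu>1) \<Otimes>\<^sub>M (\<Pi>\<^sub>M n\<in>UNIV. \<mu>2)"
proof -
  interpret prob_space M by fact
  have law: "distr M proc_space (\<lambda>\<omega> n. S n \<omega>) = (\<Pi>\<^sub>M n\<in>UNIV. \<mu>)"
    if "indep_vars (\<lambda>_. borel) S UNIV" "\<And>n. distr M borel (S n) = \<mu>"
    for S :: "int \<Rightarrow> 'a \<Rightarrow> real" and \<mu>
  proof -
    have "random_variable borel (S n)" for n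
      using that(1) by (auto simp: indep_vars_def)
    then show ?thesis
      using that indep_vars_iff_distr_eq_PiM'[where I = UNIV and M' = "\<lambda>_. borel" and X = S] by (simp add: restrict_UNIV)
  qed
  show ?thesis
    using assms(6) law[OF assms(2,3)] law[OF assms(4,5)]
    unfolding indep_var_distribution_eq by simp
qed

text \<open>Each row is a reindexed part of the product measure, and the two rows are independent
  because they use disjoint sets of coordinates.\<close>

lemma (in prob_space) distr_proc_pair_joint:
  fixes U :: "bool \<times> int \<Rightarrow> 'a \<Rightarrow> real"
  assumes U: "indep_vars (\<lambda>_. borel) U UNIV"
    and law: "\<And>n. distr M borel (U (True, n)) = \<mu>1" "\<And>n. distr M borel (U (False, n)) = \<mu>2"
  shows "distr M proc_pair_space (\<lambda>\<omega>. (\<lambda>n. U (True, n) \<omega>, \<lambda>n. U (False, n) \<omega>))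
    = (\<Pi>\<^sub>M n\<in>UNIV. \<mu>1) \<Otimes>\<^sub>M (\<Pi>\<^sub>M n\<in>UNIV. \<mu>2)"
proof (rule distr_proc_pair)
  have comp: "indep_vars (\<lambda>_. borel) (\<lambda>n. U (b, n)) UNIV" for b
  proof -
    have rv: "random_variable borel (U j)" for j
      using U unfolding indep_vars_def by blast
    have meas: "(\<lambda>\<omega> j. U j \<omega>) \<in> measurable M (\<Pi>\<^sub>M j\<in>UNIV. borel)"
      by (rule measurable_PiM_single') (use rv in auto)
    have "distr M proc_space (\<lambda>\<omega> n. U (b, n) \<omega>)
      = distr (distr M (\<Pi>\<^sub>M j\<in>UNIV. borel) (\<lambda>\<omega> j. U j \<omega>)) proc_space (\<lambda>\<omega> n. \<omega> (b, n))"
      by (subst distr_distr) (auto simp: o_def meas intro!: measurable_PiM_single' measurable_component_singleton)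
    also have "\<dots> = distr (\<Pi>\<^sub>M j\<in>UNIV. distr M borel (U j)) proc_space (\<lambda>\<omega> n. \<omega> (b, n))"
      using U rv indep_vars_iff_distr_eq_PiM'[where I = UNIV and M' = "\<lambda>_. borel" and X = U] by (simp add: restrict_UNIV)
    also have "\<dots> = distr (\<Pi>\<^sub>M j\<in>UNIV. distr M borel (U j)) (\<Pi>\<^sub>M n\<in>UNIV. distr M borel (U (b, n))) (\<lambda>\<omega> n. \<omega> (b, n))"
      by (intro distr_cong sets_PiM_cong) auto
    also have "\<dots> = (\<Pi>\<^sub>M n\<in>UNIV. distr M borel (U (b, n)))"
      using distr_PiM_reindex[of UNIV "\<lambda>j. distr M borel (U j)" "Pair b" UNIV] rv
      by (simp add: prob_space_distr inj_on_def restrict_UNIV)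
    finally show ?thesis
      using rv by (subst indep_vars_iff_distr_eq_PiM') (auto simp: restrict_UNIV)
  qed
  show "indep_vars (\<lambda>_. borel) (\<lambda>n. U (True, n)) UNIV" "indep_vars (\<lambda>_. borel) (\<lambda>n. U (False, n)) UNIV"
    by (rule comp)+
  let ?Y = "\<lambda>b (\<omega> :: bool \<times> int \<Rightarrow> real) n. \<omega> (b, n)"
  have meas: "?Y b \<in> measurable (Pi\<^sub>M ({b} \<times> UNIV) (\<lambda>_. borel)) proc_space" for b
    by (rule measurable_PiM_single') (auto intro!: measurable_component_singleton)
  have "indep_var (Pi\<^sub>M ({True} \<times> UNIV) (\<lambda>_. borel)) (\<lambda>\<omega>. restrict (\<lambda>i. U i \<omega>) ({True} \<times> UNIV))
      (Pi\<^sub>M ({False} \<times> UNIV) (\<lambda>_. borel)) (\<lambda>\<omega>. restrict (\<lambda>i. U i \<omega>) ({False} \<times> UNIV))"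
    by (rule indep_var_restrict[OF U]) auto
  from indep_var_compose[OF this meas meas]
  show "indep_var proc_space (\<lambda>\<omega> n. U (True, n) \<omega>) proc_space (\<lambda>\<omega> n. U (False, n) \<omega>)"
    by (simp add: o_def)
qed (simp_all add: law prob_space_axioms)

lemma emeasure_pair_pmf_Times:
  "emeasure (pair_pmf A B) (F \<times> G) = emeasure A F * emeasure B G"
proof -
  have "emeasure (pair_pmf A B) (F \<times> G) = (\<integral>\<^sup>+a. \<integral>\<^sup>+b. indicator F a * indicator G b \<partial>B \<partial>A)"
    by (subst nn_integral_indicator[symmetric])
       (auto simp: nn_integral_pair_pmf' indicator_times)
  then show ?thesis
    by (simp add: nn_integral_cmult nn_integral_multc)
qed

text \<open>Unzips an i.i.d. sequence of pairs with independent entries into two independent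
  sequences, by comparing the measures of cylinder sets.\<close>

lemma distr_iid_pair_real:
  fixes A B :: "nat pmf"
  shows "distr (\<Pi>\<^sub>M n\<in>UNIV. measure_pmf (pair_pmf A B)) proc_pair_space
      (\<lambda>w. (\<lambda>n. real (fst (w n)), \<lambda>n. real (snd (w n))))
    = (\<Pi>\<^sub>M n\<in>UNIV. distr A borel real) \<Otimes>\<^sub>M (\<Pi>\<^sub>M n\<in>UNIV. distr B borel real)"
proof -
  let ?N = "\<Pi>\<^sub>M n\<in>(UNIV :: int set). measure_pmf (pair_pmf A B)"
  define f :: "bool \<Rightarrow> nat \<times> nat \<Rightarrow> real" where "f b z = real (if b then fst z else snd z)" for b z
  define U where "U = (\<lambda>(j :: bool \<times> int) (w :: int \<Rightarrow> nat \<times> nat). f (fst j) (w (snd j)))"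
  define \<mu> where "\<mu> b = (if b then distr (measure_pmf A) borel real else distr (measure_pmf B) borel real)" for b
  interpret N: prob_space ?N
    by (intro prob_space_PiM measure_pmf.prob_space_axioms)
  have \<mu>: "prob_space (\<mu> b)" for b
    unfolding \<mu>_def by (auto intro!: measure_pmf.prob_space_distr)
  have sets_\<mu>: "sets (\<mu> b) = sets borel" for b
    by (auto simp: \<mu>_def)
  have coord: "(\<lambda>w. w n) \<in> measurable ?N (measure_pmf (pair_pmf A B))" for n
    by (rule measurable_component_singleton) simp
  have U[measurable]: "U j \<in> borel_measurable ?N" for j
    unfolding U_def by (rule measurable_compose[OF coord]) simp
  have distr_U: "distr ?N borel (U (b, n)) = \<mu> b" for b n
  proof -
    have "distr ?N borel (U (b, n)) = distr (distr ?N (measure_pmf (pair_pmf A B)) (\<lambda>w. w n)) borel (f b)"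
      by (subst distr_distr) (auto simp: U_def coord o_def)
    also have "\<dots> = distr (measure_pmf (pair_pmf A B)) borel (f b)"
      by (subst distr_PiM_component) (auto intro: measure_pmf.prob_space_axioms)
    also have "\<dots> = distr (measure_pmf (map_pmf (if b then fst else snd) (pair_pmf A B))) borel real"
      unfolding map_pmf_rep_eq by (subst distr_distr) (auto simp: f_def[abs_def] o_def)
    also have "\<dots> = \<mu> b"
      by (simp add: \<mu>_def map_fst_pair_pmf map_snd_pair_pmf)
    finally show ?thesis .
  qed
  have "distr ?N (\<Pi>\<^sub>M j\<in>UNIV. borel) (\<lambda>w j. U j w) = (\<Pi>\<^sub>M j\<in>UNIV. \<mu> (fst j))"
  proof (rule measure_eqI_PiM_infinite)
    show "sets (distr ?N (\<Pi>\<^sub>M j\<in>UNIV. borel) (\<lambda>w j. U j w)) = sets (\<Pi>\<^sub>M j\<in>UNIV. \<mu> (fst j))"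
      by (simp add: sets_\<mu> cong: sets_PiM_cong)
    have "(\<lambda>w j. U j w) \<in> measurable ?N (\<Pi>\<^sub>M j\<in>UNIV. borel)"
      by (rule measurable_PiM_single') auto
    then interpret D: prob_space "distr ?N (\<Pi>\<^sub>M j\<in>UNIV. borel) (\<lambda>w j. U j w)"
      by (rule N.prob_space_distr)
    show "finite_measure (distr ?N (\<Pi>\<^sub>M j\<in>UNIV. borel) (\<lambda>w j. U j w))"
      by unfold_locales
    fix J :: "(bool \<times> int) set" and F :: "bool \<times> int \<Rightarrow> real set"
    assume J: "finite J" and F: "\<And>j. j \<in> J \<Longrightarrow> F j \<in> sets (\<mu> (fst j))"
    \<comment> \<open>\<open>L\<close> is the set of times that J meets, and \<open>G\<close> pads
      \<open>F\<close> with \<open>UNIV\<close>. On the full rectangle of both indices and all times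
      in \<open>L\<close>, the event becomes a box with one rectangle \<open>R n\<close> of pairs
      per time.\<close>
    define L where "L = snd ` J"
    define G where "G j = (if j \<in> J then F j else UNIV)" for j
    have G: "G j \<in> sets borel" for j
      using F by (auto simp: G_def sets_\<mu>)
    have L: "finite L" and JL: "J \<subseteq> UNIV \<times> L"
      using J by (auto simp: L_def) (metis image_eqI snd_conv)
    define R where "R n = {a. real a \<in> G (True, n)} \<times> {s. real s \<in> G (False, n)}" for n
    let ?E = "prod_emb UNIV (\<lambda>j. \<mu> (fst j)) J (Pi\<^sub>E J F)"
    have E: "?E \<in> sets (\<Pi>\<^sub>M j\<in>UNIV. \<mu> (fst j))"
      using J F by (intro sets_PiM_I) auto
    have "emeasure (distr ?N (\<Pi>\<^sub>M j\<in>UNIV. borel) (\<lambda>w j. U j w)) ?E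
      = emeasure ?N ((\<lambda>w j. U j w) -` ?E \<inter> space ?N)"
      using E by (intro emeasure_distr) (auto simp: sets_\<mu> cong: sets_PiM_cong intro!: measurable_PiM_single')
    also have "(\<lambda>w j. U j w) -` ?E \<inter> space ?N = prod_emb UNIV (\<lambda>_. measure_pmf (pair_pmf A B)) L (Pi\<^sub>E L R)"
    proof -
      have "(\<forall>j\<in>J. U j w \<in> F j) \<longleftrightarrow> (\<forall>n\<in>L. w n \<in> R n)" for w
      proof -
        have "(\<forall>j\<in>J. U j w \<in> F j) \<longleftrightarrow> (\<forall>j\<in>UNIV \<times> L. U j w \<in> G j)"
          using JL by (auto simp: G_def)
        also have "\<dots> \<longleftrightarrow> (\<forall>n\<in>L. w n \<in> R n)"
          by (auto simp: R_def U_def f_def mem_Times_iff all_bool_eq)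
        finally show ?thesis .
      qed
      then show ?thesis
        by (auto simp: prod_emb_def space_PiM PiE_iff \<mu>_def)
    qed
    also have "emeasure ?N \<dots> = (\<Prod>n\<in>L. emeasure (measure_pmf (pair_pmf A B)) (R n))"
      using L by (intro emeasure_PiM_emb) (auto intro: measure_pmf.prob_space_axioms)
    also have "\<dots> = (\<Prod>n\<in>L. \<Prod>b\<in>UNIV. emeasure (\<mu> b) (G (b, n)))"
      unfolding R_def emeasure_pair_pmf_Times UNIV_bool
      using G by (intro prod.cong) (auto simp: \<mu>_def emeasure_distr vimage_def mult.commute)
    also have "\<dots> = (\<Prod>j\<in>UNIV \<times> L. emeasure (\<mu> (fst j)) (G j))"
      by (subst prod.swap) (simp add: prod.cartesian_product case_prod_beta')
    also have "\<dots> = (\<Prod>j\<in>J. emeasure (\<mu> (fst j)) (F j))"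
    proof (rule prod.mono_neutral_cong_right)
      show "\<forall>j\<in>UNIV \<times> L - J. emeasure (\<mu> (fst j)) (G j) = 1"
        using prob_space.emeasure_space_1[OF \<mu>] sets_eq_imp_space_eq[OF sets_\<mu>] by (simp add: G_def)
    qed (use L JL in \<open>auto simp: G_def\<close>)
    also have "\<dots> = emeasure (\<Pi>\<^sub>M j\<in>UNIV. \<mu> (fst j)) ?E"
      using J F by (intro emeasure_PiM_emb[symmetric] \<mu>) auto
    finally show "emeasure (distr ?N (\<Pi>\<^sub>M j\<in>UNIV. borel) (\<lambda>w j. U j w)) ?E
      = emeasure (\<Pi>\<^sub>M j\<in>UNIV. \<mu> (fst j)) ?E" .
  qed simp
  then have "N.indep_vars (\<lambda>_. borel) U UNIV"
    using distr_U[of "fst j" "snd j" for j]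
    by (subst N.indep_vars_iff_distr_eq_PiM') (auto simp: restrict_UNIV)
  from N.distr_proc_pair_joint[OF this distr_U distr_U] show ?thesis
    by (simp add: U_def f_def \<mu>_def)
qed

section \<open>The stationary queue\<close>

context reversible_queue
begin

primrec state :: "nat \<Rightarrow> (nat \<Rightarrow> nat \<times> nat \<times> nat \<times> nat) \<Rightarrow> nat \<Rightarrow> nat" where
  "state x w 0 = x"
| "state x w (Suc k) = fst (step (state x w k) (w k))"

text \<open>The departure and the reversed service of a step, which serve as arrival and service for
  the queue run backwards.\<close>

definition outputs :: "nat \<Rightarrow> (nat \<Rightarrow> nat \<times> nat \<times> nat \<times> nat) \<Rightarrow> nat \<Rightarrow> nat \<times> nat" where
  "outputs x w k = snd (step (state x w k) (w k))"

definition inputs :: "nat \<times> nat \<times> nat \<times> nat \<Rightarrow> nat \<times> nat" where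
  "inputs = (\<lambda>(a, s, e, g). (a, s))"

abbreviation driving :: "(nat \<Rightarrow> nat \<times> nat \<times> nat \<times> nat) measure" where
  "driving \<equiv> (\<Pi>\<^sub>M k\<in>UNIV. measure_pmf input)"

abbreviation service_pair :: "(nat \<times> nat) pmf" where
  "service_pair \<equiv> pair_pmf arr srv"

sublocale driving: prob_space driving
  by (intro prob_space_PiM measure_pmf.prob_space_axioms)

section \<open>Independence of the inputs and of the outputs\<close>

lemma state_case_nat: "state x (case_nat i w) (Suc k) = state (fst (step x i)) w k"
  by (induction k) auto

lemma outputs_case_nat:
  "outputs x (case_nat i w) 0 = snd (step x i)"
  "outputs x (case_nat i w) (Suc k) = outputs (fst (step x i)) w k"
  using state_case_nat[of x i w k] by (simp_all add: outputs_def del: state.simps(2))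

lemma map_inputs: "map_pmf inputs input = service_pair"
  unfolding inputs_def input_def pair_pmf_def
  by (simp add: map_bind_pmf bind_assoc_pmf bind_return_pmf)

lemma measurable_driving_component [measurable]: "(\<lambda>w. w k) \<in> measurable driving (count_space UNIV)"
  by (subst measurable_cong_sets[OF refl sets_measure_pmf_count_space[symmetric]])
     (rule measurable_component_singleton, simp)

lemma measurable_state [measurable]: "(\<lambda>w. state x w k) \<in> measurable driving (count_space UNIV)"
proof (induction k)
  case (Suc k)
  note [measurable] = Suc
  have "(\<lambda>w. fst (step (state x w k) (w k))) \<in> measurable driving (count_space UNIV)"
    by (rule measurable_compose_countable[where f = "\<lambda>y w. fst (step y (w k))"])
       (auto intro: measurable_compose[OF measurable_driving_component])
  then show ?case
    by simp
qed simp

lemma measurable_outputs [measurable]: "(\<lambda>w. outputs x w k) \<in> measurable driving (count_space UNIV)"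
  unfolding outputs_def
  by (rule measurable_compose_countable[where f = "\<lambda>y w. snd (step y (w k))"])
     (auto intro: measurable_compose[OF measurable_driving_component])

lemma sequence_space_input: "sequence_space (measure_pmf input)"
  by (intro sequence_space.intro product_prob_space.intro product_prob_space_axioms.intro
      product_sigma_finite.intro)
     (auto intro: measure_pmf.prob_space_axioms prob_space_imp_sigma_finite)

text \<open>An i.i.d. sequence is a first input followed by an independent copy of the sequence;
  this drives the inductions over the number of steps.\<close>

lemma nn_integral_driving:
  assumes [measurable]: "f \<in> borel_measurable driving"
  shows "(\<integral>\<^sup>+w. f w \<partial>driving) = (\<integral>\<^sup>+i. \<integral>\<^sup>+w. f (case_nat i w) \<partial>driving \<partial>measure_pmf input)"
proof -
  interpret S: sequence_space "measure_pmf input"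
    by (rule sequence_space_input)
  have meas: "(\<lambda>(i, w). case_nat i w) \<in> measurable (measure_pmf input \<Otimes>\<^sub>M driving) driving"
    by measurable
  have "(\<integral>\<^sup>+w. f w \<partial>driving) = (\<integral>\<^sup>+z. f (case_nat (fst z) (snd z)) \<partial>(measure_pmf input \<Otimes>\<^sub>M driving))"
    by (subst S.PiM_iter[symmetric], subst nn_integral_distr[OF meas]) (auto simp: case_prod_beta')
  also have "\<dots> = (\<integral>\<^sup>+i. \<integral>\<^sup>+w. f (case_nat i w) \<partial>driving \<partial>measure_pmf input)"
    using measurable_compose[OF meas assms]
    by (subst driving.nn_integral_fst[symmetric]) (auto simp: case_prod_beta')
  finally show ?thesis .
qed

lemma nn_integral_inputs_box:
  "(\<integral>\<^sup>+w. (\<Prod>k<N. indicator (F k) (inputs (w k))) \<partial>driving) = (\<Prod>k<N. emeasure service_pair (F k))"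
proof (induction N arbitrary: F)
  case 0
  show ?case
    by (simp add: driving.emeasure_space_1)
next
  case (Suc N)
  have [measurable]: "(\<lambda>w. indicator (F k) (inputs (w k)) :: ennreal) \<in> borel_measurable driving" for F k
    by (rule measurable_compose[OF measurable_driving_component]) simp
  have "(\<integral>\<^sup>+w. (\<Prod>k<Suc N. indicator (F k) (inputs (w k))) \<partial>driving)
    = (\<integral>\<^sup>+i. indicator (F 0) (inputs i) * (\<integral>\<^sup>+w. (\<Prod>k<N. indicator (F (Suc k)) (inputs (w k))) \<partial>driving) \<partial>measure_pmf input)"
    by (subst nn_integral_driving) (simp_all add: prod.lessThan_Suc_shift nn_integral_cmult del: prod.lessThan_Suc)
  also have "\<dots> = (\<integral>\<^sup>+i. indicator (F 0) (inputs i) \<partial>measure_pmf input) * (\<Prod>k<N. emeasure service_pair (F (Suc k)))"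
    by (simp add: Suc nn_integral_multc)
  also have "(\<integral>\<^sup>+i. indicator (F 0) (inputs i) \<partial>measure_pmf input) = emeasure service_pair (F 0)"
    unfolding map_inputs[symmetric]
    by (auto simp: indicator_def simp flip: nn_integral_indicator intro!: nn_integral_cong)
  finally show ?case
    by (simp add: prod.lessThan_Suc_shift del: prod.lessThan_Suc)
qed

text \<open>Started from stationarity, the outputs are i.i.d.: the first output is independent of
  the next content, which is again stationary, so the induction hypothesis applies to the
  rest.\<close>

lemma nn_integral_outputs_box:
  "(\<integral>\<^sup>+x. \<integral>\<^sup>+w. (\<Prod>k<N. indicator (F k) (outputs x w k)) \<partial>driving \<partial>stat) = (\<Prod>k<N. emeasure service_pair (F k))"
proof (induction N arbitrary: F)
  case 0
  show ?case
    by (simp add: driving.emeasure_space_1)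
next
  case (Suc N)
  have [measurable]: "(\<lambda>w. indicator (F k) (outputs x w k) :: ennreal) \<in> borel_measurable driving" for F x k
    by (rule measurable_compose[OF measurable_outputs]) simp
  define h where "h x = (\<integral>\<^sup>+w. (\<Prod>k<N. indicator (F (Suc k)) (outputs x w k)) \<partial>driving)" for x
  have "(\<integral>\<^sup>+x. \<integral>\<^sup>+w. (\<Prod>k<Suc N. indicator (F k) (outputs x w k)) \<partial>driving \<partial>stat)
    = (\<integral>\<^sup>+x. \<integral>\<^sup>+i. indicator (F 0) (snd (step x i)) * h (fst (step x i)) \<partial>measure_pmf input \<partial>stat)"
    by (subst nn_integral_driving)
       (simp_all add: prod.lessThan_Suc_shift nn_integral_cmult outputs_case_nat h_def del: prod.lessThan_Suc)
  \<comment> \<open>The first step acts on a stationary content and a fresh input, the form in which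
    \<open>map_step\<close> applies.\<close>
  also have "\<dots> = (\<integral>\<^sup>+z. indicator (F 0) (snd z) * h (fst z) \<partial>measure_pmf (map_pmf (\<lambda>(x, w). step x w) (pair_pmf stat input)))"
    by (simp add: nn_integral_pair_pmf')
  also have "\<dots> = (\<integral>\<^sup>+x. \<integral>\<^sup>+b. indicator (F 0) b * h x \<partial>measure_pmf service_pair \<partial>stat)"
    unfolding map_step by (subst nn_integral_pair_pmf') simp
  also have "\<dots> = emeasure service_pair (F 0) * (\<integral>\<^sup>+x. h x \<partial>stat)"
    by (simp add: nn_integral_multc nn_integral_cmult)
  also have "(\<integral>\<^sup>+x. h x \<partial>stat) = (\<Prod>k<N. emeasure service_pair (F (Suc k)))"
    unfolding h_def by (rule Suc)
  finally show ?case
    by (simp add: prod.lessThan_Suc_shift del: prod.lessThan_Suc)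
qed

text \<open>
  The stationary process is glued at time \<open>0\<close> from a queue driven by \<open>u\<close> forwards in time and a queue
  driven by \<open>v\<close> backwards in time, so that before time \<open>0\<close> the services are the outputs of the latter.
\<close>

definition path :: "nat \<Rightarrow> (nat \<Rightarrow> nat \<times> nat \<times> nat \<times> nat) \<Rightarrow> (nat \<Rightarrow> nat \<times> nat \<times> nat \<times> nat) \<Rightarrow> int \<Rightarrow> nat" where
  "path x u v n = (if n \<ge> 0 then state x u (nat n) else state x v (nat (- n)))"

definition services :: "nat \<Rightarrow> (nat \<Rightarrow> nat \<times> nat \<times> nat \<times> nat) \<Rightarrow> (nat \<Rightarrow> nat \<times> nat \<times> nat \<times> nat) \<Rightarrow> int \<Rightarrow> nat \<times> nat" where
  "services x u v n = (if n \<ge> 0 then inputs (u (nat n)) else outputs x v (nat (- n - 1)))"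

abbreviation base :: "(nat \<times> (nat \<Rightarrow> nat \<times> nat \<times> nat \<times> nat) \<times> (nat \<Rightarrow> nat \<times> nat \<times> nat \<times> nat)) measure" where
  "base \<equiv> measure_pmf stat \<Otimes>\<^sub>M (driving \<Otimes>\<^sub>M driving)"

sublocale driving2: pair_prob_space driving driving ..

sublocale base: pair_prob_space "measure_pmf stat" "driving \<Otimes>\<^sub>M driving" ..

lemma measurable_services_component [measurable]:
  "(\<lambda>(x, u, v). services x u v n) \<in> measurable base (count_space UNIV)"
proof -
  have "(\<lambda>z. services x (fst (snd z)) (snd (snd z)) n) \<in> measurable base (count_space UNIV)" for x
  proof (cases "n \<ge> 0")
    case True
    then show ?thesis
      unfolding services_def
      by (auto intro!: measurable_compose[OF _ measurable_compose[OF measurable_driving_component, of inputs]])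
  next
    case False
    then show ?thesis
      unfolding services_def by (auto intro!: measurable_compose[OF _ measurable_outputs])
  qed
  from measurable_compose_countable[OF this, where g = fst] show ?thesis
    by (simp add: case_prod_beta')
qed

lemma measurable_services:
  "(\<lambda>(x, u, v). services x u v) \<in> measurable base (\<Pi>\<^sub>M n\<in>UNIV. measure_pmf service_pair)"
  using measurable_services_component by (intro measurable_PiM_single') (auto simp: case_prod_beta')

text \<open>Times from 0 on use \<open>u\<close>, times before 0 use x and \<open>v\<close>. The
  former services are i.i.d. and do not involve x, the latter are i.i.d. once x is averaged over
  \<open>stat\<close>, so the two halves multiply.\<close>

lemma distr_services:
  "distr base (\<Pi>\<^sub>M n\<in>UNIV. measure_pmf service_pair) (\<lambda>(x, u, v). services x u v)
    = (\<Pi>\<^sub>M n\<in>UNIV. measure_pmf service_pair)"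
proof (rule measure_eqI_PiM_infinite)
  interpret D: prob_space "distr base (\<Pi>\<^sub>M n\<in>UNIV. measure_pmf service_pair) (\<lambda>(x, u, v). services x u v)"
    by (rule base.prob_space_distr[OF measurable_services])
  show "finite_measure (distr base (\<Pi>\<^sub>M n\<in>UNIV. measure_pmf service_pair) (\<lambda>(x, u, v). services x u v))"
    by unfold_locales
  fix J :: "int set" and F :: "int \<Rightarrow> (nat \<times> nat) set"
  assume J: "finite J"
  let ?E = "prod_emb UNIV (\<lambda>_. measure_pmf service_pair) J (Pi\<^sub>E J F)"
  have E: "?E \<in> sets (\<Pi>\<^sub>M n\<in>UNIV. measure_pmf service_pair)"
    using J by (intro sets_PiM_I) auto
  define G where "G n = (if n \<in> J then F n else UNIV)" for n
  \<comment> \<open>\<open>N\<close> is so large that the window from -N to N - 1 contains J; its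
    negative times are written -k - 1 to match the indices of \<open>outputs\<close>.\<close>
  define N where "N = Suc (nat (\<Sum>n\<in>J. \<bar>n\<bar>))"
  have "n \<in> {- int N..<int N}" if "n \<in> J" for n
    using member_le_sum[of n J abs] J that by (auto simp: N_def)
  then have JN: "J \<subseteq> {- int N..<int N}"
    by blast
  have split_int: "{- int N..<int N} = int ` {..<N} \<union> (\<lambda>k. - int k - 1) ` {..<N}"
  proof (intro equalityI subsetI)
    fix n assume n: "n \<in> {- int N..<int N}"
    show "n \<in> int ` {..<N} \<union> (\<lambda>k. - int k - 1) ` {..<N}"
    proof (cases "n \<ge> 0")
      case True
      then have "n = int (nat n)" "nat n < N" using n by auto
      then show ?thesis by blast
    next
      case False
      then have "n = - int (nat (- n - 1)) - 1" "nat (- n - 1) < N" using n by auto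
      then show ?thesis by blast
    qed
  qed auto
  define A :: "(nat \<Rightarrow> nat \<times> nat \<times> nat \<times> nat) \<Rightarrow> ennreal"
    where "A u = (\<Prod>k<N. indicator (G (int k)) (inputs (u k)))" for u
  define B :: "nat \<Rightarrow> (nat \<Rightarrow> nat \<times> nat \<times> nat \<times> nat) \<Rightarrow> ennreal"
    where "B x v = (\<Prod>k<N. indicator (G (- int k - 1)) (outputs x v k))" for x v
  have [measurable]: "A \<in> borel_measurable driving"
    unfolding A_def[abs_def]
    by (intro borel_measurable_prod_ennreal measurable_compose[OF measurable_driving_component]) simp
  have [measurable]: "B x \<in> borel_measurable driving" for x
    unfolding B_def[abs_def]
    by (intro borel_measurable_prod_ennreal measurable_compose[OF measurable_outputs]) simp
  have sf: "sigma_finite_measure (driving \<Otimes>\<^sub>M driving)"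
    by unfold_locales
  have [measurable]: "(\<lambda>z. B (fst z) (snd (snd z))) \<in> borel_measurable base"
    by (rule measurable_compose_countable[where f = "\<lambda>x z. B x (snd (snd z))" and g = fst]) measurable
  have "emeasure (distr base (\<Pi>\<^sub>M n\<in>UNIV. measure_pmf service_pair) (\<lambda>(x, u, v). services x u v)) ?E
    = (\<integral>\<^sup>+z. indicator ?E (case z of (x, u, v) \<Rightarrow> services x u v) \<partial>base)"
    using E by (subst nn_integral_distr[OF measurable_services, symmetric]) auto
  also have "\<dots> = (\<integral>\<^sup>+z. A (fst (snd z)) * B (fst z) (snd (snd z)) \<partial>base)"
  proof (rule nn_integral_cong, clarify)
    fix x u v
    have "services x u v \<in> ?E \<longleftrightarrow> (\<forall>n\<in>J. services x u v n \<in> F n)"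
      by (auto simp: prod_emb_def PiE_iff)
    also have "\<dots> \<longleftrightarrow> (\<forall>n\<in>{- int N..<int N}. services x u v n \<in> G n)"
      using JN by (auto simp: G_def)
    also have "\<dots> \<longleftrightarrow> (\<forall>k<N. inputs (u k) \<in> G (int k)) \<and> (\<forall>k<N. outputs x v k \<in> G (- int k - 1))"
      unfolding split_int ball_Un ball_simps by (simp add: services_def lessThan_def)
    finally show "indicator ?E (services x u v)
        = A (fst (snd (x, u, v))) * B (fst (x, u, v)) (snd (snd (x, u, v)))"
      unfolding A_def B_def by (auto simp: indicator_def prod_zero_iff intro!: prod.neutral)
  qed
  also have "\<dots> = (\<integral>\<^sup>+x. \<integral>\<^sup>+u. \<integral>\<^sup>+v. A u * B x v \<partial>driving \<partial>driving \<partial>stat)"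
    by (simp add: sigma_finite_measure.nn_integral_fst[OF sf, symmetric] driving.nn_integral_fst[symmetric])
  \<comment> \<open>The factor \<open>A u\<close> does not involve x, so only the outputs are
    averaged over the stationary content.\<close>
  also have "\<dots> = (\<integral>\<^sup>+u. A u \<partial>driving) * (\<integral>\<^sup>+x. \<integral>\<^sup>+v. B x v \<partial>driving \<partial>stat)"
    by (simp add: nn_integral_cmult nn_integral_multc)
  also have "\<dots> = (\<Prod>k<N. emeasure service_pair (G (int k))) * (\<Prod>k<N. emeasure service_pair (G (- int k - 1)))"
    unfolding A_def B_def nn_integral_inputs_box nn_integral_outputs_box ..
  also have "\<dots> = (\<Prod>n\<in>{- int N..<int N}. emeasure service_pair (G n))"
    unfolding split_int
    by (subst prod.union_disjoint) (auto simp: prod.reindex inj_on_def)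
  also have "\<dots> = (\<Prod>n\<in>J. emeasure service_pair (F n))"
    using JN measure_pmf.emeasure_space_1[of service_pair]
    by (intro prod.mono_neutral_cong_right) (auto simp: G_def)
  also have "\<dots> = emeasure (\<Pi>\<^sub>M n\<in>UNIV. measure_pmf service_pair) ?E"
    using J by (intro emeasure_PiM_emb[symmetric] measure_pmf.prob_space_axioms) auto
  finally show "emeasure (distr base (\<Pi>\<^sub>M n\<in>UNIV. measure_pmf service_pair) (\<lambda>(x, u, v). services x u v)) ?E
    = emeasure (\<Pi>\<^sub>M n\<in>UNIV. measure_pmf service_pair) ?E" .
qed simp_all

end

section \<open>The coupling\<close>

text \<open>
  The whole path \<open>X\<close> is written in terms of \<open>X 0 = x\<close>, so that only a countable existential
  quantifier remains and the predicate is measurable.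
\<close>

definition reversible_services :: "((int \<Rightarrow> real) \<times> (int \<Rightarrow> real)) \<times> ((int \<Rightarrow> real) \<times> (int \<Rightarrow> real)) \<Rightarrow> bool" where
  "reversible_services = (\<lambda>((s1, s2), (t1, t2)).
     (\<forall>n. 0 \<le> s1 n \<and> 0 \<le> s2 n \<and> 0 \<le> t1 n \<and> 0 \<le> t2 n) \<and>
     (\<exists>x :: nat. \<forall>n. let X = (\<lambda>n. real x + (\<Sum>k\<in>{0..<n}. s1 k - t2 k) - (\<Sum>k\<in>{n..<0}. s1 k - t2 k))
        in 0 \<le> X n \<and> reversible_step (X n) (s1 n) (s2 n) (t2 n) (t1 n) (X (n + 1))))"

lemma measurable_proc_pair_coordinates [measurable]:
  fixes n :: int
  defines "M \<equiv> proc_pair_space \<Otimes>\<^sub>M proc_pair_space"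
  shows "(\<lambda>z. fst (fst z) n) \<in> borel_measurable M" "(\<lambda>z. snd (fst z) n) \<in> borel_measurable M"
    "(\<lambda>z. fst (snd z) n) \<in> borel_measurable M" "(\<lambda>z. snd (snd z) n) \<in> borel_measurable M"
proof -
  have coord: "(\<lambda>w. w n) \<in> borel_measurable proc_space"
    by (rule measurable_component_singleton) simp
  show "(\<lambda>z. fst (fst z) n) \<in> borel_measurable M" "(\<lambda>z. snd (fst z) n) \<in> borel_measurable M"
    "(\<lambda>z. fst (snd z) n) \<in> borel_measurable M" "(\<lambda>z. snd (snd z) n) \<in> borel_measurable M"
    unfolding M_def by (auto intro!: measurable_compose[OF _ coord])
qed

lemma measurable_reversible_services [measurable]:
  "Measurable.pred (proc_pair_space \<Otimes>\<^sub>M proc_pair_space) reversible_services"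
proof -
  let ?M = "proc_pair_space \<Otimes>\<^sub>M proc_pair_space"
  define X where "X x z n = real x + (\<Sum>k\<in>{0..<n}. fst (fst z) k - snd (snd z) k)
      - (\<Sum>k\<in>{n..<0}. fst (fst z) k - snd (snd z) k)"
    for x and z :: "((int \<Rightarrow> real) \<times> (int \<Rightarrow> real)) \<times> (int \<Rightarrow> real) \<times> (int \<Rightarrow> real)" and n
  have [measurable]: "(\<lambda>z. X x z n) \<in> borel_measurable ?M" for x n
    unfolding X_def by (intro borel_measurable_add borel_measurable_diff borel_measurable_sum borel_measurable_const) measurable
  have "Measurable.pred ?M (\<lambda>z. (\<forall>n. 0 \<le> fst (fst z) n \<and> 0 \<le> snd (fst z) n \<and> 0 \<le> fst (snd z) n \<and> 0 \<le> snd (snd z) n) \<and>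
      (\<exists>x. \<forall>n. 0 \<le> X x z n \<and> reversible_step (X x z n) (fst (fst z) n) (snd (fst z) n) (snd (snd z) n) (fst (snd z) n) (X x z (n + 1))))"
    unfolding reversible_step_def by measurable
  then show ?thesis
    unfolding reversible_services_def X_def Let_def case_prod_beta' .
qed

lemma departure_reversible_services:
  assumes "reversible_services ((s1, s2), (t1, t2))" "\<And>n. 0 \<le> A n"
  shows "departure (departure A s1) s2 = departure (departure A t1) t2"
proof -
  from assms(1) obtain x where x: "\<And>n. let X = (\<lambda>n. real x + (\<Sum>k\<in>{0..<n}. s1 k - t2 k) - (\<Sum>k\<in>{n..<0}. s1 k - t2 k))
      in 0 \<le> X n \<and> reversible_step (X n) (s1 n) (s2 n) (t2 n) (t1 n) (X (n + 1))"
    and nn: "0 \<le> s1 n" "0 \<le> s2 n" "0 \<le> t1 n" "0 \<le> t2 n" for n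
    unfolding reversible_services_def by blast
  show ?thesis
    using x nn assms(2) unfolding Let_def
    by (intro tandem_interchange[where X = "\<lambda>n. real x + (\<Sum>k\<in>{0..<n}. s1 k - t2 k) - (\<Sum>k\<in>{n..<0}. s1 k - t2 k)"]) auto
qed

text \<open>Telescoping away from time 0 in both directions; on either side of 0 one of the two sums
  is empty.\<close>

lemma path_eq_sum:
  fixes X f :: "int \<Rightarrow> real"
  assumes "\<And>n. X (n + 1) = X n + f n"
  shows "X n = X 0 + (\<Sum>k\<in>{0..<n}. f k) - (\<Sum>k\<in>{n..<0}. f k)"
proof (induction n rule: int_induct[where k = 0])
  case (step1 i)
  then have "{0..<i + 1} = insert i {0..<i}" "{i..<0} = {}" "{i + 1..<0} = {}"
    by auto
  then show ?case
    using step1 assms[of i] by simp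
next
  case (step2 i)
  then have "{i - 1..<0} = insert (i - 1) {i..<0}" "{0..<i} = {}" "{0..<i - 1} = {}"
    by auto
  then show ?case
    using step2 assms[of "i - 1"] by simp
qed simp

lemma reversible_step_sym: "reversible_step x a s d r x' \<longleftrightarrow> reversible_step x' d r a s x"
  by (auto simp: reversible_step_def)

lemma reversible_step_real:
  "reversible_step (real x) (real a) (real s) (real d) (real r) (real x') \<longleftrightarrow> reversible_step x a s d r x'"
  by (simp add: reversible_step_def flip: of_nat_add)

definition real_pair :: "(int \<Rightarrow> nat \<times> nat) \<Rightarrow> (int \<Rightarrow> real) \<times> (int \<Rightarrow> real)" where
  "real_pair w = (\<lambda>n. real (fst (w n)), \<lambda>n. real (snd (w n)))"

lemma measurable_real_pair [measurable]:
  "real_pair \<in> measurable (\<Pi>\<^sub>M n\<in>UNIV. measure_pmf P) proc_pair_space"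
proof -
  have coord: "(\<lambda>w. w n) \<in> measurable (\<Pi>\<^sub>M n\<in>UNIV. measure_pmf P) (measure_pmf P)" for n :: int
    by (rule measurable_component_singleton) simp
  have "(\<lambda>w. real (f (w n))) \<in> borel_measurable (\<Pi>\<^sub>M n\<in>UNIV. measure_pmf P)" for f and n :: int
    by (rule measurable_compose[OF coord]) simp
  then show ?thesis
    unfolding real_pair_def[abs_def]
    by (intro measurable_Pair measurable_PiM_single') auto
qed

context reversible_queue
begin

lemma reversible_step_step:
  "reversible_step x (fst (inputs w)) (snd (inputs w)) (fst (snd (step x w))) (snd (snd (step x w))) (fst (step x w))"
  by (cases w) (auto simp: inputs_def reversible_step_def Let_def min_def)

text \<open>For n \<ge> 0 this is a step of the chain driven by \<open>u\<close>, for n < 0 a step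
  of the chain driven by \<open>v\<close> read backwards. The reflection n -> -n - 1 matches the
  step from n to n + 1 with the one from -n - 1 to -n and exchanges \<open>u\<close> and
  \<open>v\<close>.\<close>

lemma reversible_step_services:
  "reversible_step (path x u v n) (fst (services x u v n)) (snd (services x u v n))
     (fst (services x v u (- n - 1))) (snd (services x v u (- n - 1))) (path x u v (n + 1))"
proof (cases "n \<ge> 0")
  case True
  then have "nat (n + 1) = Suc (nat n)"
    by simp
  then show ?thesis
    using True reversible_step_step by (simp add: path_def services_def outputs_def)
next
  case False
  define k where "k = nat (- n - 1)"
  have n: "n = - int k - 1"
    using False by (simp add: k_def)
  \<comment> \<open>For k = 0 this is time 0, where both chains start from x.\<close>
  have "path x u v (n + 1) = state x v k"
    by (simp add: n path_def)
  moreover have "nat (1 + int k) = Suc k"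
    by simp
  ultimately show ?thesis
    using reversible_step_step[of "state x v k" "v k"]
    by (subst reversible_step_sym) (simp add: n path_def services_def outputs_def)
qed

abbreviation service_law :: "((int \<Rightarrow> real) \<times> (int \<Rightarrow> real)) measure" where
  "service_law \<equiv> (\<Pi>\<^sub>M n\<in>UNIV. distr arr borel real) \<Otimes>\<^sub>M (\<Pi>\<^sub>M n\<in>UNIV. distr srv borel real)"

definition reversed_services :: "nat \<Rightarrow> (nat \<Rightarrow> nat \<times> nat \<times> nat \<times> nat) \<Rightarrow> (nat \<Rightarrow> nat \<times> nat \<times> nat \<times> nat) \<Rightarrow> int \<Rightarrow> nat \<times> nat" where
  "reversed_services x u v n = services x v u (- n - 1)"

text \<open>Two symmetries combine: exchanging \<open>u\<close> and \<open>v\<close> preserves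
  \<open>base\<close>, and reflecting time preserves the law of an i.i.d. sequence.\<close>

lemma
  shows measurable_reversed_services:
    "(\<lambda>(x, u, v). reversed_services x u v) \<in> measurable base (\<Pi>\<^sub>M n\<in>UNIV. measure_pmf service_pair)"
  and distr_reversed_services:
    "distr base (\<Pi>\<^sub>M n\<in>UNIV. measure_pmf service_pair) (\<lambda>(x, u, v). reversed_services x u v)
      = (\<Pi>\<^sub>M n\<in>UNIV. measure_pmf service_pair)"
proof -
  let ?P = "\<Pi>\<^sub>M n\<in>(UNIV :: int set). measure_pmf service_pair"
  let ?swap = "\<lambda>(x :: nat, u :: nat \<Rightarrow> nat \<times> nat \<times> nat \<times> nat, v :: nat \<Rightarrow> nat \<times> nat \<times> nat \<times> nat). (x, v, u)"
  let ?rev = "\<lambda>(w :: int \<Rightarrow> nat \<times> nat) n. w (- n - 1)"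
  have swap: "?swap \<in> measurable base base"
    by measurable
  have rev: "?rev \<in> measurable ?P ?P"
    by (rule measurable_PiM_single') (auto intro!: measurable_component_singleton)
  have eq: "(\<lambda>(x, u, v). reversed_services x u v) = ?rev \<circ> ((\<lambda>(x, u, v). services x u v) \<circ> ?swap)"
    by (auto simp: fun_eq_iff reversed_services_def)
  show "(\<lambda>(x, u, v). reversed_services x u v) \<in> measurable base ?P"
    unfolding eq by (intro measurable_comp[OF measurable_comp[OF swap measurable_services] rev])
  have "distr (driving \<Otimes>\<^sub>M driving) (driving \<Otimes>\<^sub>M driving) (\<lambda>(u, v). (v, u)) = driving \<Otimes>\<^sub>M driving"
    using driving2.distr_pair_swap by simp
  then have "base = distr (measure_pmf stat) (measure_pmf stat) (\<lambda>x. x) \<Otimes>\<^sub>M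
      distr (driving \<Otimes>\<^sub>M driving) (driving \<Otimes>\<^sub>M driving) (\<lambda>(u, v). (v, u))"
    by (simp only: distr_id2[OF refl])
  also have "\<dots> = distr base base (\<lambda>(x, y). (x, case y of (u, v) \<Rightarrow> (v, u)))"
  proof (rule pair_measure_distr)
    show "sigma_finite_measure (distr (driving \<Otimes>\<^sub>M driving) (driving \<Otimes>\<^sub>M driving) (\<lambda>(u, v). (v, u)))"
      unfolding \<open>distr (driving \<Otimes>\<^sub>M driving) _ _ = _\<close> by unfold_locales
  qed measurable
  also have "(\<lambda>(x, y). (x, case y of (u, v) \<Rightarrow> (v, u))) = ?swap"
    by (auto simp: fun_eq_iff)
  finally have swap_base: "distr base base ?swap = base" ..
  have "distr base ?P (\<lambda>(x, u, v). reversed_services x u v) = distr (distr (distr base base ?swap) ?P (\<lambda>(x, u, v). services x u v)) ?P ?rev"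
    unfolding eq by (simp only: distr_distr[OF measurable_services swap] distr_distr[OF rev measurable_comp[OF swap measurable_services]])
  also have "\<dots> = distr ?P ?P ?rev"
    by (simp only: swap_base distr_services)
  also have "\<dots> = ?P"
    using distr_PiM_reindex[of UNIV "\<lambda>_. measure_pmf service_pair" "\<lambda>n :: int. - n - 1" UNIV]
    by (simp add: inj_on_def restrict_UNIV measure_pmf.prob_space_axioms)
  finally show "distr base ?P (\<lambda>(x, u, v). reversed_services x u v) = ?P" .
qed

text \<open>\<open>reversed_services\<close> lists the departure first and the reversed service
  second, that is (t2, t1); the swap restores the order (t1, t2).\<close>

lemma reversible_services_services:
  "reversible_services (real_pair (services x u v), prod.swap (real_pair (reversed_services x u v)))"
proof -
  have R: "reversible_step (path x u v n) (fst (services x u v n)) (snd (services x u v n))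
     (fst (reversed_services x u v n)) (snd (reversed_services x u v n)) (path x u v (n + 1))" for n
    unfolding reversed_services_def by (rule reversible_step_services)
  have "real (path x u v (n + 1)) = real (path x u v n)
      + (real (fst (services x u v n)) - real (fst (reversed_services x u v n)))" for n
    using R[of n] unfolding reversible_step_def by linarith
  from path_eq_sum[of "\<lambda>n. real (path x u v n)", OF this]
  have X: "real (path x u v n) = real x
      + (\<Sum>k\<in>{0..<n}. real (fst (services x u v k)) - real (fst (reversed_services x u v k)))
      - (\<Sum>k\<in>{n..<0}. real (fst (services x u v k)) - real (fst (reversed_services x u v k)))" for n
    by (simp add: path_def)
  show ?thesis
    unfolding reversible_services_def real_pair_def
    by (auto simp only: Let_def prod.case swap_simp X[symmetric] reversible_step_real R of_nat_0_le_iff intro!: exI[of _ x])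
qed

text \<open>The coupling is an image of \<open>base\<close>: both pairs are functions of the same
  stationary path, and there the reversible steps hold at every point.\<close>

lemma ex_reversible_coupling:
  "\<exists>Q. prob_space Q \<and> sets Q = sets (proc_pair_space \<Otimes>\<^sub>M proc_pair_space) \<and>
     distr Q proc_pair_space fst = service_law \<and>
     distr Q proc_pair_space (prod.swap \<circ> snd) = service_law \<and>
     (AE z in Q. reversible_services z)"
proof -
  let ?g = "\<lambda>(x, u, v). (real_pair (services x u v), prod.swap (real_pair (reversed_services x u v)))"
  have meas_swap: "prod.swap \<in> measurable proc_pair_space proc_pair_space"
    by (simp add: prod.swap_def[abs_def])
  have m1: "(\<lambda>(x, u, v). real_pair (services x u v)) \<in> measurable base proc_pair_space"
    using measurable_compose[OF measurable_services measurable_real_pair] by (simp add: case_prod_beta')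
  have m2: "(\<lambda>(x, u, v). real_pair (reversed_services x u v)) \<in> measurable base proc_pair_space"
    using measurable_compose[OF measurable_reversed_services measurable_real_pair] by (simp add: case_prod_beta')
  have g: "?g \<in> measurable base (proc_pair_space \<Otimes>\<^sub>M proc_pair_space)"
    using measurable_Pair[OF m1 measurable_compose[OF m2 meas_swap]] by (simp add: case_prod_beta')
  let ?Q = "distr base (proc_pair_space \<Otimes>\<^sub>M proc_pair_space) ?g"
  have law: "distr base proc_pair_space (\<lambda>(x, u, v). real_pair (f x u v)) = service_law"
    if "(\<lambda>(x, u, v). f x u v) \<in> measurable base (\<Pi>\<^sub>M n\<in>UNIV. measure_pmf service_pair)"
      "distr base (\<Pi>\<^sub>M n\<in>UNIV. measure_pmf service_pair) (\<lambda>(x, u, v). f x u v) = (\<Pi>\<^sub>M n\<in>UNIV. measure_pmf service_pair)"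
    for f
  proof -
    have "distr base proc_pair_space (\<lambda>(x, u, v). real_pair (f x u v))
      = distr (distr base (\<Pi>\<^sub>M n\<in>UNIV. measure_pmf service_pair) (\<lambda>(x, u, v). f x u v)) proc_pair_space real_pair"
      by (subst distr_distr[OF measurable_real_pair that(1)]) (simp add: o_def case_prod_beta')
    also have "\<dots> = service_law"
      unfolding that(2) using distr_iid_pair_real by (simp add: real_pair_def[abs_def])
    finally show ?thesis .
  qed
  have "prob_space ?Q"
    by (rule base.prob_space_distr[OF g])
  moreover have "distr ?Q proc_pair_space fst = service_law"
    using law[OF measurable_services distr_services]
    by (subst distr_distr[OF _ g]) (simp_all add: o_def case_prod_beta')
  moreover have "distr ?Q proc_pair_space (prod.swap \<circ> snd) = service_law"
    using law[OF measurable_reversed_services distr_reversed_services]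
    by (subst distr_distr[OF _ g]) (simp_all add: o_def case_prod_beta' measurable_compose[OF measurable_snd meas_swap])
  moreover have "AE z in ?Q. reversible_services z"
    by (subst AE_distr_iff[OF g]) (auto simp: reversible_services_services)
  ultimately show ?thesis
    by (intro exI[of _ ?Q]) simp
qed

end

section \<open>Parameters with equal c\<close>

lemma c_param_eq:
  assumes "p \<in> {0..1}" "a \<in> {0<..1}"
  shows "c_param p a = (if p = 0 then 0 else if p = 1 \<or> a = 1 then \<infinity> else ereal (p * a / ((1 - p) * (1 - a))))"
proof -
  have frac: "ereal x / ereal (1 - x) = (if x = 1 then \<infinity> else ereal (x / (1 - x)))" if "0 \<le> x" for x
    using that by (auto simp: divide_ereal_def divide_inverse)
  show ?thesis
    using assms unfolding c_param_def
    by (auto simp: frac ereal_mult_infty zero_ereal_def[symmetric] less_le)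
qed

text \<open>Both laws are the point mass at 0. When both values of c are 0, the geometric parameters
  need not be related.\<close>

lemma ber_geom_nat_0:
  assumes "a \<in> {0<..1}" "b \<in> {0<..1}"
  shows "ber_geom_nat 0 a = ber_geom_nat 0 b"
proof (rule pmf_eqI)
  show "pmf (ber_geom_nat 0 a) k = pmf (ber_geom_nat 0 b) k" for k
    using assms by (cases k) (simp_all add: pmf_ber_geom_nat)
qed

text \<open>From \<beta> < \<alpha> \<le> 1 the denominator is positive and the ratio is less than
  1.\<close>

lemma reversible_queueI:
  assumes "p \<in> {0..1}" "\<alpha> \<in> {0<..1}" "q \<in> {0..1}" "\<beta> \<in> {0<..1}"
    and "\<beta> < \<alpha>" "p * \<alpha> * (1 - q) * (1 - \<beta>) = q * \<beta> * (1 - p) * (1 - \<alpha>)"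
  shows "reversible_queue p \<alpha> q \<beta> ((1 - \<alpha>) / (1 - \<beta>))"
  using assms by unfold_locales (auto simp: field_simps)

text \<open>Split by the common value of c: at 0 the laws agree; at infinity it matters which
  parameters equal 1; otherwise \<alpha> and \<beta> are compared, the larger one belonging to the
  arrivals.\<close>

lemma reversible_queue_cases:
  assumes p: "p \<in> {0..1}" and \<alpha>: "\<alpha> \<in> {0<..1}" and q: "q \<in> {0..1}" and \<beta>: "\<beta> \<in> {0<..1}"
    and c: "c_param p \<alpha> = c_param q \<beta>"
  shows "ber_geom_nat p \<alpha> = ber_geom_nat q \<beta> \<or>
    (\<exists>\<rho>. reversible_queue p \<alpha> q \<beta> \<rho>) \<or> (\<exists>\<rho>. reversible_queue q \<beta> p \<alpha> \<rho>)"
proof -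
  note c' = c[unfolded c_param_eq[OF p \<alpha>] c_param_eq[OF q \<beta>]]
  have pos: "0 < x * y / ((1 - x) * (1 - y))" if "x \<in> {0..1}" "y \<in> {0<..1}" "x \<noteq> 0" "x \<noteq> 1" "y \<noteq> 1" for x y :: real
    using that by (intro divide_pos_pos mult_pos_pos) auto
  have zero: "p = 0 \<longleftrightarrow> q = 0"
    using c' pos[OF p \<alpha>] pos[OF q \<beta>] \<alpha> \<beta> by (auto simp: zero_ereal_def split: if_splits)
  consider (zero) "p = 0" "q = 0" | (both) "p = 1" "q = 1" | (det) "\<alpha> = 1" "\<beta> = 1" "p \<noteq> 0" "q \<noteq> 0"
    | (left) "p = 1" "\<beta> = 1" "q \<noteq> 0" | (right) "\<alpha> = 1" "q = 1" "p \<noteq> 0"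
    | (fin) "p \<noteq> 1" "q \<noteq> 1" "\<alpha> \<noteq> 1" "\<beta> \<noteq> 1" "p * \<alpha> / ((1 - p) * (1 - \<alpha>)) = q * \<beta> / ((1 - q) * (1 - \<beta>))"
    using c' zero \<alpha> \<beta> by (auto split: if_splits)
  then show ?thesis
  proof cases
    case zero
    then show ?thesis
      using ber_geom_nat_0[OF \<alpha> \<beta>] by simp
  next
    case both
    then show ?thesis
      using reversible_queueI[OF p \<alpha> q \<beta>] reversible_queueI[OF q \<beta> p \<alpha>]
      by (cases \<alpha> \<beta> rule: linorder_cases) auto
  next
    case left
    \<comment> \<open>Arrivals are at most 1 and every service is at least 1, so the stationary
      queue is empty and \<rho> = 0.\<close>
    then have "reversible_queue q \<beta> p \<alpha> 0"
      using p \<alpha> q \<beta> by unfold_locales auto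
    then show ?thesis
      by blast
  next
    case right
    then have "reversible_queue p \<alpha> q \<beta> 0"
      using p \<alpha> q \<beta> by unfold_locales auto
    then show ?thesis
      by blast
  next
    case det
    \<comment> \<open>With batches of size at most 1 on both sides \<open>ratio\<close> reads 0 = 0,
      and \<rho> is solved from \<open>balance\<close>; x < y makes it less than 1.\<close>
    have *: "reversible_queue x 1 y 1 (x * (1 - y) / ((1 - x) * y))"
      if "x \<in> {0..1}" "y \<in> {0..1}" "x < y" for x y :: real
    proof -
      have "x * (1 - y) / ((1 - x) * y) < 1"
        using that by (subst divide_less_eq_1_pos) (auto simp: algebra_simps)
      then show ?thesis
        using that by unfold_locales auto
    qed
    show ?thesis
      using *[OF p q] *[OF q p] det by (cases p q rule: linorder_cases) auto
  next
    case fin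
    have eq: "p * \<alpha> * (1 - q) * (1 - \<beta>) = q * \<beta> * (1 - p) * (1 - \<alpha>)"
      using fin by (simp add: frac_eq_eq mult_ac)
    show ?thesis
    proof (cases \<alpha> \<beta> rule: linorder_cases)
      case less
      then show ?thesis
        using reversible_queueI[OF q \<beta> p \<alpha>] eq by auto
    next
      case equal
      then have "\<alpha> * (1 - \<alpha>) * (p * (1 - q)) = \<alpha> * (1 - \<alpha>) * (q * (1 - p))"
        using eq by (simp add: mult_ac)
      moreover have "\<alpha> * (1 - \<alpha>) \<noteq> 0"
        using \<alpha> fin by simp
      ultimately have "p * (1 - q) = q * (1 - p)"
        by (metis mult_left_cancel)
      then have "p = q"
        by (simp add: algebra_simps)
      then show ?thesis
        using equal by simp
    next
      case greater
      then show ?thesis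
        using reversible_queueI[OF p \<alpha> q \<beta>] eq by auto
    qed
  qed
qed

lemma distr_ber_geom: "distr (measure_pmf (ber_geom p a)) borel (\<lambda>x. x) = distr (measure_pmf (ber_geom_nat p a)) borel real"
  unfolding ber_geom_eq_map map_pmf_rep_eq by (subst distr_distr) (auto simp: o_def)

text \<open>The conclusion quantifies over uncountably many A. It is deduced pointwise on the almost
  sure event \<open>reversible_services\<close>, so its own measurability does not arise.\<close>

lemma AE_departure_reversible_services:
  assumes "AE z in Q. reversible_services z"
  shows "AE ((s1, s2), (t1, t2)) in Q. \<forall>A :: int \<Rightarrow> real. (\<forall>n. A n \<ge> 0) \<longrightarrow>
     departure (departure A s1) s2 = departure (departure A t1) t2"
  using assms by eventually_elim (use departure_reversible_services in \<open>auto split: prod.splits\<close>)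

theorem theorem6p1:
  fixes M :: "'w measure"
    and S1 S2 :: "int \<Rightarrow> 'w \<Rightarrow> real"
    and p q \<alpha> \<beta> :: real
  assumes "prob_space M"
    and "p \<in> {0..1}" and "\<alpha> \<in> {0<..1}" and "q \<in> {0..1}" and "\<beta> \<in> {0<..1}"
    and "prob_space.indep_vars M (\<lambda>_. borel) S1 UNIV"
    and "\<And>n. distr M borel (S1 n) = distr (measure_pmf (ber_geom p \<alpha>)) borel (\<lambda>x. x)"
    and "prob_space.indep_vars M (\<lambda>_. borel) S2 UNIV"
    and "\<And>n. distr M borel (S2 n) = distr (measure_pmf (ber_geom q \<beta>)) borel (\<lambda>x. x)"
    and "prob_space.indep_var M proc_space (\<lambda>\<omega> n. S1 n \<omega>) proc_space (\<lambda>\<omega> n. S2 n \<omega>)"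
    and "c_param p \<alpha> = c_param q \<beta>"
  shows "\<exists>Q :: (((int \<Rightarrow> real) \<times> (int \<Rightarrow> real)) \<times> ((int \<Rightarrow> real) \<times> (int \<Rightarrow> real))) measure.
      prob_space Q \<and>
      sets Q = sets (proc_pair_space \<Otimes>\<^sub>M proc_pair_space) \<and>
      distr Q proc_pair_space (\<lambda>((s1, s2), (t1, t2)). (s1, s2))
        = distr M proc_pair_space (\<lambda>\<omega>. (\<lambda>n. S1 n \<omega>, \<lambda>n. S2 n \<omega>)) \<and>
      distr Q proc_pair_space (\<lambda>((s1, s2), (t1, t2)). (t2, t1))
        = distr M proc_pair_space (\<lambda>\<omega>. (\<lambda>n. S1 n \<omega>, \<lambda>n. S2 n \<omega>)) \<and>
      (AE ((s1, s2), (t1, t2)) in Q. \<forall>A :: int \<Rightarrow> real. (\<forall>n. A n \<ge> 0) \<longrightarrow>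
         departure (departure A s1) s2 = departure (departure A t1) t2)"
proof -
  define law where "law p a = distr (measure_pmf (ber_geom_nat p a)) borel real" for p a
  define P where "P p a = (\<Pi>\<^sub>M n\<in>(UNIV :: int set). law p a)" for p a
  let ?PP = "proc_pair_space \<Otimes>\<^sub>M proc_pair_space"
  have sets_P: "sets (P p a) = sets proc_space" for p a
    unfolding P_def law_def by (intro sets_PiM_cong) auto
  have prob_P: "prob_space (P p a)" for p a
    unfolding P_def law_def by (intro prob_space_PiM measure_pmf.prob_space_distr) auto
  have swap_P: "distr (P q \<beta> \<Otimes>\<^sub>M P p \<alpha>) proc_pair_space prod.swap = P p \<alpha> \<Otimes>\<^sub>M P q \<beta>" for p \<alpha> q \<beta>
  proof -
    interpret A: prob_space "P p \<alpha>" by (rule prob_P)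
    interpret B: prob_space "P q \<beta>" by (rule prob_P)
    interpret pair_sigma_finite "P p \<alpha>" "P q \<beta>" ..
    have "P p \<alpha> \<Otimes>\<^sub>M P q \<beta> = distr (P q \<beta> \<Otimes>\<^sub>M P p \<alpha>) (P p \<alpha> \<Otimes>\<^sub>M P q \<beta>) (\<lambda>(x, y). (y, x))"
      by (rule distr_pair_swap)
    also have "\<dots> = distr (P q \<beta> \<Otimes>\<^sub>M P p \<alpha>) proc_pair_space prod.swap"
      by (intro distr_cong sets_pair_measure_cong sets_P) auto
    finally show ?thesis
      by simp
  qed
  have L: "distr M proc_pair_space (\<lambda>\<omega>. (\<lambda>n. S1 n \<omega>, \<lambda>n. S2 n \<omega>)) = P p \<alpha> \<Otimes>\<^sub>M P q \<beta>"
    using distr_proc_pair[OF assms(1,6,7,8,9,10)] by (simp add: P_def law_def distr_ber_geom)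
  have proj: "(\<lambda>((s1, s2), (t1, t2)). (s1, s2)) = fst" "(\<lambda>((s1, s2), (t1, t2)). (t2, t1)) = prod.swap \<circ> snd"
    by (auto simp: fun_eq_iff)
  have meas_swap: "prod.swap \<in> measurable proc_pair_space proc_pair_space"
    by (simp add: prod.swap_def[abs_def])
  have coupling: "\<exists>Q. prob_space Q \<and> sets Q = sets ?PP \<and> distr Q proc_pair_space fst = P p \<alpha> \<Otimes>\<^sub>M P q \<beta> \<and>
      distr Q proc_pair_space (prod.swap \<circ> snd) = P p \<alpha> \<Otimes>\<^sub>M P q \<beta> \<and> (AE z in Q. reversible_services z)"
    if "reversible_queue p \<alpha> q \<beta> \<rho>" for p \<alpha> q \<beta> \<rho>
    unfolding P_def law_def by (rule reversible_queue.ex_reversible_coupling[OF that])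
  show ?thesis
    using reversible_queue_cases[OF assms(2-5,11)] unfolding L proj
  proof (elim disjE exE)
    assume "ber_geom_nat p \<alpha> = ber_geom_nat q \<beta>"
    then have eq: "P q \<beta> = P p \<alpha>"
      by (simp add: P_def law_def)
    let ?L = "P p \<alpha> \<Otimes>\<^sub>M P p \<alpha>"
    interpret pair_prob_space "P p \<alpha>" "P p \<alpha>"
      by (intro pair_prob_space.intro pair_sigma_finite.intro prob_space_imp_sigma_finite prob_P)
    have diag: "(\<lambda>z. (z, z)) \<in> measurable ?L ?PP"
      by (simp add: measurable_cong_sets[OF sets_pair_measure_cong[OF sets_P sets_P] refl] measurable_Pair)
    \<comment> \<open>With equal laws the diagonal coupling t1 = s1, t2 = s2 works, since the common
      product law is symmetric.\<close>
    let ?Q = "distr ?L ?PP (\<lambda>z. (z, z))"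
    have "distr ?Q proc_pair_space fst = ?L"
      using sets_pair_measure_cong[OF sets_P sets_P]
      by (subst distr_distr[OF _ diag]) (auto simp: o_def intro!: distr_id2)
    moreover have "distr ?Q proc_pair_space (prod.swap \<circ> snd) = ?L"
      using swap_P[of p \<alpha> p \<alpha>] measurable_compose[OF measurable_snd meas_swap]
      by (subst distr_distr[OF _ diag]) (auto simp: o_def)
    moreover have pred_eq: "Measurable.pred ?PP (\<lambda>z. f z = g z)"
      if "f \<in> borel_measurable ?PP" "g \<in> borel_measurable ?PP" for f g :: "_ \<Rightarrow> real"
      using that by measurable
    \<comment> \<open>Equality of the two pairs is a countable conjunction over coordinates, hence
      measurable.\<close>
    have "Measurable.pred ?PP (\<lambda>z. \<forall>n. fst (fst z) n = fst (snd z) n \<and> snd (fst z) n = snd (snd z) n)"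
      by (intro pred_intros_countable pred_intros_logic pred_eq measurable_proc_pair_coordinates)
    then have "AE z in ?Q. \<forall>n. fst (fst z) n = fst (snd z) n \<and> snd (fst z) n = snd (snd z) n"
      by (subst AE_distr_iff[OF diag]) (simp_all add: pred_def)
    then have "AE ((s1, s2), (t1, t2)) in ?Q. \<forall>A :: int \<Rightarrow> real. (\<forall>n. A n \<ge> 0) \<longrightarrow>
         departure (departure A s1) s2 = departure (departure A t1) t2"
      by eventually_elim (auto simp: all_conj_distrib simp flip: fun_eq_iff)
    ultimately show "\<exists>Q. prob_space Q \<and> sets Q = sets ?PP \<and> distr Q proc_pair_space fst = P p \<alpha> \<Otimes>\<^sub>M P q \<beta> \<and>
      distr Q proc_pair_space (prod.swap \<circ> snd) = P p \<alpha> \<Otimes>\<^sub>M P q \<beta> \<and>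
      (AE ((s1, s2), (t1, t2)) in Q. \<forall>A :: int \<Rightarrow> real. (\<forall>n. A n \<ge> 0) \<longrightarrow>
         departure (departure A s1) s2 = departure (departure A t1) t2)"
      unfolding eq using prob_space_distr[OF diag] by (intro exI[of _ ?Q]) simp
  next
    fix \<rho> assume "reversible_queue p \<alpha> q \<beta> \<rho>"
    from coupling[OF this] show "\<exists>Q. prob_space Q \<and> sets Q = sets ?PP \<and> distr Q proc_pair_space fst = P p \<alpha> \<Otimes>\<^sub>M P q \<beta> \<and>
      distr Q proc_pair_space (prod.swap \<circ> snd) = P p \<alpha> \<Otimes>\<^sub>M P q \<beta> \<and>
      (AE ((s1, s2), (t1, t2)) in Q. \<forall>A :: int \<Rightarrow> real. (\<forall>n. A n \<ge> 0) \<longrightarrow>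
         departure (departure A s1) s2 = departure (departure A t1) t2)"
      using AE_departure_reversible_services by blast
  next
    fix \<rho> assume "reversible_queue q \<beta> p \<alpha> \<rho>"
    from coupling[OF this] obtain Q where "prob_space Q" and sets_Q: "sets Q = sets ?PP"
      and fst_Q: "distr Q proc_pair_space fst = P q \<beta> \<Otimes>\<^sub>M P p \<alpha>"
      and snd_Q: "distr Q proc_pair_space (prod.swap \<circ> snd) = P q \<beta> \<Otimes>\<^sub>M P p \<alpha>"
      and AE_Q: "AE z in Q. reversible_services z"
      by blast
    interpret Q: prob_space Q by fact
    note meas_Q = measurable_cong_sets[OF sets_Q refl]
    have swap_PP: "prod.swap \<in> measurable ?PP ?PP"
      by (simp add: prod.swap_def[abs_def])
    then have swap: "prod.swap \<in> measurable Q ?PP"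
      unfolding meas_Q .
    have fst_meas: "fst \<in> measurable Q proc_pair_space"
      unfolding meas_Q by simp
    \<comment> \<open>\<open>Q\<close> couples the services in the opposite order, so its second
      pair (t1, t2) has the law required of (s1, s2). Exchanging the two pairs gives the coupling,
      as equality of outputs is symmetric.\<close>
    let ?Q = "distr Q ?PP prod.swap"
    have "distr ?Q proc_pair_space fst = distr Q proc_pair_space snd"
      by (subst distr_distr[OF _ swap]) (auto simp: o_def)
    also have "\<dots> = distr (distr Q proc_pair_space (prod.swap \<circ> snd)) proc_pair_space prod.swap"
      by (subst distr_distr[OF meas_swap]) (auto simp: o_def meas_Q intro: measurable_compose[OF measurable_snd meas_swap])
    finally have "distr ?Q proc_pair_space fst = P p \<alpha> \<Otimes>\<^sub>M P q \<beta>"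
      unfolding snd_Q swap_P .
    moreover have "distr ?Q proc_pair_space (prod.swap \<circ> snd) = distr (distr Q proc_pair_space fst) proc_pair_space prod.swap"
      unfolding distr_distr[OF measurable_comp[OF measurable_snd meas_swap] swap] distr_distr[OF meas_swap fst_meas]
      by (simp add: o_def)
    then have "distr ?Q proc_pair_space (prod.swap \<circ> snd) = P p \<alpha> \<Otimes>\<^sub>M P q \<beta>"
      unfolding fst_Q swap_P .
    moreover have "AE z in ?Q. reversible_services (prod.swap z)"
      using AE_Q measurable_compose[OF swap_PP measurable_reversible_services]
      by (subst AE_distr_iff[OF swap]) (simp_all add: pred_def)
    then have "AE ((s1, s2), (t1, t2)) in ?Q. \<forall>A :: int \<Rightarrow> real. (\<forall>n. A n \<ge> 0) \<longrightarrow>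
         departure (departure A s1) s2 = departure (departure A t1) t2"
      by eventually_elim (clarsimp split: prod.splits, metis departure_reversible_services)
    ultimately show "\<exists>Q. prob_space Q \<and> sets Q = sets ?PP \<and> distr Q proc_pair_space fst = P p \<alpha> \<Otimes>\<^sub>M P q \<beta> \<and>
      distr Q proc_pair_space (prod.swap \<circ> snd) = P p \<alpha> \<Otimes>\<^sub>M P q \<beta> \<and>
      (AE ((s1, s2), (t1, t2)) in Q. \<forall>A :: int \<Rightarrow> real. (\<forall>n. A n \<ge> 0) \<longrightarrow>
         departure (departure A s1) s2 = departure (departure A t1) t2)"
      using Q.prob_space_distr[OF swap] by (intro exI[of _ ?Q]) simp
  qed
qed

end
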